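(* Let $G$ be a finite abelian group and $\mathbf A$ a commutative $\mathbb{Q}$-algebra with unit. The map $$\mathsf{EDS}(G)(\mathbf A)\longrightarrow\mathsf{DMR}(G)(\mathbf A),\qquad Z_{\mathbf A}\longmapsto\Phi_{Z_{\mathbf A}\circ\overline{\mathrm{reg}}}$$ is bijective.
   Context: $G$ is written multiplicatively with identity $1$; $X_G=\{x_0\}\sqcup\{x_g: g\in G\}$ ($x_1$ is the letter attached to $1\in G$), and $X_G^*$ is the set of words in $X_G$. $\mathfrak{H}_G=\mathbb{Q}\langle X_G\rangle$ is the free associative unital algebra, $\mathfrak{H}^1_G=\mathbb{Q}+\sum_{g\in G}\mathfrak{H}_Gx_g$ and $\mathfrak{H}^0_G=\mathbb{Q}+\sum_{g\in G}x_0\mathfrak{H}_Gx_g+\sum_{g\in G\smallsetminus\{1\}}x_g\mathfrak{H}^1_G$. Put $y_{n,g}=x_0^{n-1}x_g$ ($n\geq1$, $g\in G$), $Y_G=\{y_{n,g}\}$; $\mathfrak{H}^1_G$ is the free algebra on $Y_G$. Shuffle product $\mathrm{sh}$ on $\mathfrak{H}_G$: $\mathbb{Q}$-bilinear, $1\,\mathrm{sh}\,w=w\,\mathrm{sh}\,1=w$, $uw_1\,\mathrm{sh}\,vw_2=u(w_1\,\mathrm{sh}\,vw_2)+v(uw_1\,\mathrm{sh}\,w_2)$ for letters $u,v\in X_G$ and words $w_1,w_2$. Harmonic product $*$ on $\mathfrak{H}^1_G$: $\mathbb{Q}$-bilinear, $1*w=w*1=w$, $y_{n_1,g_1}w_1*y_{n_2,g_2}w_2=y_{n_1,g_1}(w_1*y_{n_2,g_2}w_2)+y_{n_2,g_2}(y_{n_1,g_1}w_1*w_2)+y_{n_1+n_2,g_1g_2}(w_1*w_2)$.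 The commutative algebras $\mathfrak{H}_{G,\mathrm{sh}},\mathfrak{H}^1_{G,\mathrm{sh}},\mathfrak{H}^0_{G,\mathrm{sh}}$ and $\mathfrak{H}^1_{G,*}$ are the corresponding spaces with the indicated products. Algebra homomorphisms are unital. $\mathrm{q}_G$ is the $\mathbb{Q}$-linear automorphism of $\mathfrak{H}_G$ with $\mathrm{q}_G(x_0^{n_1-1}x_{g_1}x_0^{n_2-1}x_{g_2}\cdots x_0^{n_r-1}x_{g_r}x_0^{n_{r+1}-1})=x_0^{n_1-1}x_{g_1}x_0^{n_2-1}x_{g_2g_1^{-1}}\cdots x_0^{n_r-1}x_{g_rg_{r-1}^{-1}}x_0^{n_{r+1}-1}$; it restricts to $\mathfrak{H}^1_G$ and $\mathfrak{H}^0_G$. $\overline{\mathrm{reg}}^T:\mathfrak{H}_{G,\mathrm{sh}}\to\mathfrak{H}^0_{G,\mathrm{sh}}[T]$ is the unique $\mathbb{Q}$-algebra homomorphism that is the identity on $\mathfrak{H}^0_G$ and sends $x_0\mapsto0$, $x_1\mapsto T$; $\overline{\mathrm{reg}}:\mathfrak{H}_{G,\mathrm{sh}}\to\mathfrak{H}^0_{G,\mathrm{sh}}$ is its composition with evaluation at $T=0$. For a $\mathbb{Q}$-algebra homomorphism $Z_{\mathbf A}:\mathfrak{H}^0_{G,\mathrm{sh}}\to\mathbf A$, $Z^{\mathrm{sh}}_{\mathbf A}:\mathfrak{H}^1_{G,\mathrm{sh}}\to\mathbf{A}[T]$ is the restriction of $\overline{\mathrm{reg}}^T$ to $\mathfrak{H}^1_G$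 followed by applying $Z_{\mathbf A}$ to coefficients. $\rho_{Z_{\mathbf A}}$ is the $\mathbf{A}$-module automorphism of $\mathbf{A}[T]$ determined (coefficientwise in a formal parameter $u$) by $\rho_{Z_{\mathbf A}}(\exp(Tu))=\exp\big(\sum_{n\geq2}\frac{(-1)^n}{n}Z_{\mathbf A}(x_0^{n-1}x_1)u^n\big)\exp(Tu)$. $\mathsf{EDS}(G)(\mathbf A)$ is the set of $\mathbb{Q}$-linear maps $Z_{\mathbf A}:\mathfrak{H}^0_G\to\mathbf A$ such that (a) $Z_{\mathbf A}:\mathfrak{H}^0_{G,\mathrm{sh}}\to\mathbf A$ is an algebra homomorphism, and (b) $\rho_{Z_{\mathbf A}}^{-1}\circ Z^{\mathrm{sh}}_{\mathbf A}\circ\mathrm{q}_G^{-1}:\mathfrak{H}^1_{G,*}\to\mathbf{A}[T]$ is an algebra homomorphism. For a $\mathbb{Q}$-linear map $Z_{\mathbf A}:\mathfrak{H}^0_G\to\mathbf A$, $\Phi_{Z_{\mathbf A}\circ\overline{\mathrm{reg}}}=\sum_{w\in X_G^*}Z_{\mathbf A}(\overline{\mathrm{reg}}(w))\,w\in\mathbf A\langle\langle X_G\rangle\rangle$, where $\mathbf A\langle\langle X_G\rangle\rangle$ is the algebra of non-commutative formal power series. $(\Phi\mid w)$ denotes the coefficient of the word $w$ in $\Phi$. $\mathbf A\langle\langle Y_G\rangle\rangle$ is the algebra of non-commutative formal power series in $Y_G$ (degree of $y_{n,g}$ is $n$), viewed as a subalgebra of $\mathbf A\langle\langle X_G\rangle\rangle$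 via $y_{n,g}=x_0^{n-1}x_g$; one has $\mathbf A\langle\langle X_G\rangle\rangle=\mathbf A\langle\langle Y_G\rangle\rangle\oplus\mathbf A\langle\langle X_G\rangle\rangle x_0$, and $\pi_{Y_G}$ is the projection onto the first summand. $\mathbf{q}_G$ is the continuous $\mathbf A$-linear extension of $\mathrm{q}_G$ to $\mathbf A\langle\langle X_G\rangle\rangle$. $\widehat\Delta_{G,\mathrm{sh}}$ is the (continuous) $\mathbf A$-algebra homomorphism $\mathbf A\langle\langle X_G\rangle\rangle\to\mathbf A\langle\langle X_G\rangle\rangle^{\hat\otimes2}$ with $x_g\mapsto x_g\otimes1+1\otimes x_g$ for $g\in G\sqcup\{0\}$. $\widehat\Delta_{G,*}$ is the (continuous) $\mathbf A$-algebra homomorphism $\mathbf A\langle\langle Y_G\rangle\rangle\to\mathbf A\langle\langle Y_G\rangle\rangle^{\hat\otimes2}$ with $y_{n,g}\mapsto y_{n,g}\otimes1+1\otimes y_{n,g}+\sum_{k=1}^{n-1}\sum_{h\in G}y_{k,h}\otimes y_{n-k,gh^{-1}}$. $\mathsf{DMR}(G)(\mathbf A)$ is the set of $\Phi\in\mathbf A\langle\langle X_G\rangle\rangle$ with $(\Phi\mid x_0)=(\Phi\mid x_1)=0$ such that (a) $\widehat\Delta_{G,\mathrm{sh}}(\Phi)=\Phi\otimes\Phi$ and $(\Phi\mid1)=1$; (b) $\widehat\Delta_{G,*}(\Phi_* )=\Phi_*\otimes\Phi_*$, where $\Phi_*=\Phi_{\mathrm{corr}}\cdot\pi_{Y_G}(\mathbf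 q_G(\Phi))$ and $\Phi_{\mathrm{corr}}=\exp\big(\sum_{n\geq2}\frac{(-1)^{n-1}}{n}(\Phi\mid x_0^{n-1}x_1)x_1^n\big)$. *)

theory Defs
  imports
    Complex_Main
    "HOL-Library.FuncSet"
    "HOL-Library.Poly_Mapping"
    "HOL-Computational_Algebra.Polynomial"
    "HOL-Computational_Algebra.Formal_Power_Series"
begin

section \<open>Rational vector spaces and commutative rational algebras\<close>

class rat_module = ab_group_add +
  fixes scaleQ :: "rat \<Rightarrow> 'a \<Rightarrow> 'a"  (infixr "*\<^sub>Q" 75)
  assumes scaleQ_add_right: "r *\<^sub>Q (x + y) = r *\<^sub>Q x + r *\<^sub>Q y"
    and scaleQ_add_left: "(r + s) *\<^sub>Q x = r *\<^sub>Q x + s *\<^sub>Q x"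
    and scaleQ_scaleQ: "r *\<^sub>Q s *\<^sub>Q x = (r * s) *\<^sub>Q x"
    and scaleQ_one: "1 *\<^sub>Q x = x"

text \<open>
  The class \<open>comm_ring_1\<close> is avoided because it demands \<open>0 \<noteq> 1\<close>; with the class below the zero
  algebra is admitted. As a consequence the unit of \<open>'a poly\<close> is written \<open>[:1:]\<close>.
\<close>

class comm_rat_algebra = rat_module + comm_ring + comm_monoid_mult +
  assumes scaleQ_mult_left: "(r *\<^sub>Q x) * y = r *\<^sub>Q (x * y)"

lemma scaleQ_zero_right: "r *\<^sub>Q (0 :: 'a :: rat_module) = 0"
  using scaleQ_add_right[of r "0 :: 'a" 0] by simp

instantiation rat :: comm_rat_algebra
begin

definition scaleQ_rat :: "rat \<Rightarrow> rat \<Rightarrow> rat" where "scaleQ_rat = (*)"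

instance by standard (simp_all add: scaleQ_rat_def algebra_simps)

end

instantiation poly_mapping :: (type, rat_module) rat_module
begin

definition scaleQ_poly_mapping :: "rat \<Rightarrow> ('a \<Rightarrow>\<^sub>0 'b) \<Rightarrow> ('a \<Rightarrow>\<^sub>0 'b)" where
  "scaleQ_poly_mapping r = Poly_Mapping.map (scaleQ r)"

lemma lookup_scaleQ:
  "Poly_Mapping.lookup (r *\<^sub>Q p) k = r *\<^sub>Q Poly_Mapping.lookup p k" for p :: "'a \<Rightarrow>\<^sub>0 'b"
  by (simp add: scaleQ_poly_mapping_def Poly_Mapping.map.rep_eq when_def scaleQ_zero_right)

instance
  by standard
    (rule poly_mapping_eqI;
     simp add: lookup_scaleQ lookup_add scaleQ_add_right scaleQ_add_left scaleQ_scaleQ scaleQ_one)+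

end

instantiation poly :: (rat_module) rat_module
begin

definition scaleQ_poly :: "rat \<Rightarrow> 'a poly \<Rightarrow> 'a poly" where
  "scaleQ_poly r = map_poly (scaleQ r)"

lemma coeff_scaleQ: "coeff (r *\<^sub>Q p) n = r *\<^sub>Q coeff p n" for p :: "'a poly"
  by (simp add: scaleQ_poly_def coeff_map_poly scaleQ_zero_right)

instance
  by standard
    (rule poly_eqI;
     simp add: coeff_scaleQ scaleQ_add_right scaleQ_add_left scaleQ_scaleQ scaleQ_one)+

end

definition linearQ_on :: "'v :: rat_module set \<Rightarrow> ('v \<Rightarrow> 'w :: rat_module) \<Rightarrow> bool" where
  "linearQ_on S f \<longleftrightarrow>
     (\<forall>p\<in>S. \<forall>q\<in>S. f (p + q) = f p + f q) \<and> (\<forall>r. \<forall>p\<in>S. f (r *\<^sub>Q p) = r *\<^sub>Q f p)"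

text \<open>
  \<open>alg_hom_on S m e m' e' f\<close>: on the algebra with underlying space \<open>S\<close>, product \<open>m\<close> and unit \<open>e\<close>,
  the map \<open>f\<close> is a unital homomorphism into an algebra with product \<open>m'\<close> and unit \<open>e'\<close>.
\<close>

definition alg_hom_on ::
  "'v :: rat_module set \<Rightarrow> ('v \<Rightarrow> 'v \<Rightarrow> 'v) \<Rightarrow> 'v \<Rightarrow>
   ('w :: rat_module \<Rightarrow> 'w \<Rightarrow> 'w) \<Rightarrow> 'w \<Rightarrow> ('v \<Rightarrow> 'w) \<Rightarrow> bool" where
  "alg_hom_on S m e m' e' f \<longleftrightarrow>
     linearQ_on S f \<and> f e = e' \<and> (\<forall>p\<in>S. \<forall>q\<in>S. f (m p q) = m' (f p) (f q))"

section \<open>Free algebras\<close>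

text \<open>
  \<open>'x falg\<close> is the underlying space of the free associative rational algebra on the alphabet \<open>'x\<close>:
  finitely supported rational combinations of words.
\<close>

type_synonym 'x falg = "'x list \<Rightarrow>\<^sub>0 rat"

definition word :: "'x list \<Rightarrow> 'x falg" where
  "word w = Poly_Mapping.single w 1"

definition lin_ext :: "('x list \<Rightarrow> 'v :: rat_module) \<Rightarrow> 'x falg \<Rightarrow> 'v" where
  "lin_ext f p = (\<Sum>w\<in>Poly_Mapping.keys p. Poly_Mapping.lookup p w *\<^sub>Q f w)"

definition bilin_ext :: "('x list \<Rightarrow> 'x list \<Rightarrow> 'v :: rat_module) \<Rightarrow> 'x falg \<Rightarrow> 'x falg \<Rightarrow> 'v" where
  "bilin_ext f p q = lin_ext (\<lambda>u. lin_ext (f u) q) p"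

definition conc :: "'x falg \<Rightarrow> 'x falg \<Rightarrow> 'x falg"  (infixl "\<odot>" 70) where
  "p \<odot> q = bilin_ext (\<lambda>u v. word (u @ v)) p q"

fun sh_word :: "'x list \<Rightarrow> 'x list \<Rightarrow> 'x falg" where
  "sh_word [] w = word w"
| "sh_word w [] = word w"
| "sh_word (u # w1) (v # w2) =
     word [u] \<odot> sh_word w1 (v # w2) + word [v] \<odot> sh_word (u # w1) w2"

definition sh :: "'x falg \<Rightarrow> 'x falg \<Rightarrow> 'x falg" where
  "sh = bilin_ext sh_word"

section \<open>The alphabets attached to a finite abelian group\<close>

text \<open>
  The group is written additively, so that the library class \<open>ab_group_add\<close> applies: its neutral
  element is \<open>0\<close>, and \<open>g - h\<close> stands for $g h^{-1}$. The letters are \<open>X0\<close> for $x_0$ and \<open>X g\<close> for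
  $x_g$; in particular \<open>X 0\<close> is the letter $x_1$ attached to the neutral element, not $x_0$.
  \<open>Y m g\<close> is the letter $y_{m+1,g} = x_0^m x_g$, the index being shifted so that all
  values of \<open>m\<close> are admissible.
\<close>

datatype 'g xletter = X0 | X 'g

datatype 'g yletter = Y nat 'g

type_synonym 'g H = "'g xletter falg"

definition H1 :: "'g :: {finite, ab_group_add} H set" where
  "H1 = {c *\<^sub>Q word [] + (\<Sum>g\<in>UNIV. h g \<odot> word [X g]) | c h. True}"

definition H0 :: "'g :: {finite, ab_group_add} H set" where
  "H0 = {c *\<^sub>Q word [] + (\<Sum>g\<in>UNIV. word [X0] \<odot> h g \<odot> word [X g])
           + (\<Sum>g\<in>UNIV - {0}. word [X g] \<odot> k g) | c h k. \<forall>g. k g \<in> H1}"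

text \<open>
  The subalgebra \<open>H1\<close> is freely generated by the \<open>Y m g\<close>; as the carrier of the harmonic product
  it is represented by \<open>'g yletter falg\<close>, and \<open>y_embed\<close> is the isomorphism onto \<open>H1\<close>.
\<close>

fun y_to_x :: "'g yletter \<Rightarrow> 'g xletter list" where
  "y_to_x (Y m g) = replicate m X0 @ [X g]"

definition y_word :: "'g yletter list \<Rightarrow> 'g xletter list" where
  "y_word w = concat (map y_to_x w)"

definition y_embed :: "'g yletter falg \<Rightarrow> 'g H" where
  "y_embed = lin_ext (\<lambda>w. word (y_word w))"

fun harm_word :: "'g :: ab_group_add yletter list \<Rightarrow> 'g yletter list \<Rightarrow> 'g yletter falg" where
  "harm_word [] w = word w"
| "harm_word w [] = word w"
| "harm_word (Y m1 g1 # w1) (Y m2 g2 # w2) =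
     word [Y m1 g1] \<odot> harm_word w1 (Y m2 g2 # w2)
     + word [Y m2 g2] \<odot> harm_word (Y m1 g1 # w1) w2
     + word [Y (m1 + m2 + 1) (g1 + g2)] \<odot> harm_word w1 w2"

definition harm :: "'g :: ab_group_add yletter falg \<Rightarrow> 'g yletter falg \<Rightarrow> 'g yletter falg" where
  "harm = bilin_ext harm_word"

text \<open>
  The accumulator \<open>h\<close> is the group element of the last letter different from \<open>X0\<close> read so far,
  and initially the neutral element.
\<close>

fun q_word_from :: "'g :: ab_group_add \<Rightarrow> 'g xletter list \<Rightarrow> 'g xletter list" where
  "q_word_from h [] = []"
| "q_word_from h (X0 # w) = X0 # q_word_from h w"
| "q_word_from h (X g # w) = X (g - h) # q_word_from g w"

definition q_word :: "'g :: ab_group_add xletter list \<Rightarrow> 'g xletter list" where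
  "q_word = q_word_from 0"

definition qG :: "'g :: ab_group_add H \<Rightarrow> 'g H" where
  "qG = lin_ext (\<lambda>w. word (q_word w))"

section \<open>Shuffle regularization\<close>

text \<open>
  \<open>sh_poly\<close> is the product of polynomials in one commuting variable whose coefficients are
  multiplied by the shuffle product.
\<close>

definition sh_poly :: "'x falg poly \<Rightarrow> 'x falg poly \<Rightarrow> 'x falg poly" where
  "sh_poly P Q =
     (\<Sum>i\<le>degree P. \<Sum>j\<le>degree Q. monom (sh (coeff P i) (coeff Q j)) (i + j))"

definition is_regT ::
  "('g :: {finite, ab_group_add} H \<Rightarrow> 'g H poly) \<Rightarrow> bool" where
  "is_regT R \<longleftrightarrow>
     (\<forall>p n. coeff (R p) n \<in> H0) \<and>
     alg_hom_on UNIV sh (word []) sh_poly [:word []:] R \<and>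
     (\<forall>p\<in>H0. R p = [:p:]) \<and>
     R (word [X0]) = 0 \<and>
     R (word [X 0]) = monom (word []) 1"

definition regT :: "'g :: {finite, ab_group_add} H \<Rightarrow> 'g H poly" where
  "regT = (THE R. is_regT R)"

text \<open>Evaluation at \<open>T = 0\<close> is the constant coefficient.\<close>

definition reg :: "'g :: {finite, ab_group_add} H \<Rightarrow> 'g H" where
  "reg p = coeff (regT p) 0"

definition Z_sh ::
  "('g :: {finite, ab_group_add} H \<Rightarrow> 'a :: comm_rat_algebra) \<Rightarrow> 'g H \<Rightarrow> 'a poly" where
  "Z_sh Z p = map_poly Z (regT p)"

section \<open>Extended double shuffle relations\<close>

text \<open>
  The exponential of a series without constant term: the summands with \<open>n > k\<close> do not contribute
  to the coefficient of degree \<open>k\<close>.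
\<close>

definition fps_expQ :: "'a :: comm_rat_algebra fps \<Rightarrow> 'a fps" where
  "fps_expQ s = Abs_fps (\<lambda>k. \<Sum>n\<le>k. (1 / fact n) *\<^sub>Q fps_nth (((*) s ^^ n) 1) k)"

text \<open>The series \<open>exp (T u)\<close> in \<open>u\<close>, with coefficients polynomials in \<open>T\<close>.\<close>

definition exp_Tu :: "'a :: comm_rat_algebra poly fps" where
  "exp_Tu = Abs_fps (\<lambda>m. monom ((1 / fact m) *\<^sub>Q 1) m)"

definition rho_series ::
  "('g :: {finite, ab_group_add} H \<Rightarrow> 'a :: comm_rat_algebra) \<Rightarrow> 'a fps" where
  "rho_series Z = fps_expQ (Abs_fps (\<lambda>n.
     if n \<ge> 2 then ((-1) ^ n / of_nat n) *\<^sub>Q Z (word (replicate (n - 1) X0 @ [X 0])) else 0))"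

definition is_rho ::
  "('g :: {finite, ab_group_add} H \<Rightarrow> 'a :: comm_rat_algebra) \<Rightarrow> ('a poly \<Rightarrow> 'a poly) \<Rightarrow> bool"
where
  "is_rho Z r \<longleftrightarrow>
     (\<forall>p q. r (p + q) = r p + r q) \<and> (\<forall>a p. r (smult a p) = smult a (r p)) \<and>
     Abs_fps (\<lambda>m. r (fps_nth exp_Tu m)) =
       Abs_fps (\<lambda>k. [:fps_nth (rho_series Z) k:]) * exp_Tu"

definition rho ::
  "('g :: {finite, ab_group_add} H \<Rightarrow> 'a :: comm_rat_algebra) \<Rightarrow> 'a poly \<Rightarrow> 'a poly" where
  "rho Z = (THE r. is_rho Z r)"

text \<open>
  Maps defined on the subspace \<open>H0\<close> only are represented by functions that are
  \<open>undefined\<close> outside \<open>H0\<close>.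
\<close>

definition EDS ::
  "('g :: {finite, ab_group_add} H \<Rightarrow> 'a :: comm_rat_algebra) set" where
  "EDS = {Z \<in> extensional H0.
     linearQ_on H0 Z \<and>
     alg_hom_on H0 sh (word []) (*) 1 Z \<and>
     alg_hom_on UNIV harm (word []) (*) [:1:] (inv (rho Z) \<circ> Z_sh Z \<circ> inv qG \<circ> y_embed)}"

section \<open>Non-commutative formal power series\<close>

text \<open>
  A non-commutative series is the function assigning to each word its coefficient; \<open>'x series2\<close> is
  the completed tensor square.
\<close>

type_synonym ('x, 'a) series = "'x list \<Rightarrow> 'a"

type_synonym ('x, 'a) series2 = "'x list \<times> 'x list \<Rightarrow> 'a"

definition ser_word :: "'x list \<Rightarrow> ('x, 'a :: comm_rat_algebra) series" where
  "ser_word w = (\<lambda>v. if v = w then 1 else 0)"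

definition ser_mult ::
  "('x, 'a :: comm_rat_algebra) series \<Rightarrow> ('x, 'a) series \<Rightarrow> ('x, 'a) series" where
  "ser_mult F G = (\<lambda>w. \<Sum>i\<le>length w. F (take i w) * G (drop i w))"

text \<open>As above, the argument is meant to have no constant term.\<close>

definition ser_exp :: "('x, 'a :: comm_rat_algebra) series \<Rightarrow> ('x, 'a) series" where
  "ser_exp F = (\<lambda>w. \<Sum>n\<le>length w. (1 / fact n) *\<^sub>Q ((ser_mult F ^^ n) (ser_word [])) w)"

definition tens ::
  "('x, 'a :: comm_rat_algebra) series \<Rightarrow> ('x, 'a) series \<Rightarrow> ('x, 'a) series2" where
  "tens F G = (\<lambda>(u, v). F u * G v)"

definition ser2_mult ::
  "('x, 'a :: comm_rat_algebra) series2 \<Rightarrow> ('x, 'a) series2 \<Rightarrow> ('x, 'a) series2" where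
  "ser2_mult F G = (\<lambda>(u, v). \<Sum>i\<le>length u. \<Sum>j\<le>length v.
     F (take i u, take j v) * G (drop i u, drop j v))"

text \<open>
  The multiplicative extension to words of a map given on letters, and the continuous linear
  extension to series of a map given on words. The latter presupposes that the sum is finite for
  every \<open>v\<close>. This holds in the three uses below, where the words occurring in \<open>L w\<close> have the same
  total degree as \<open>w\<close> and the group is finite.
\<close>

fun word_hom ::
  "('x \<Rightarrow> ('x, 'a :: comm_rat_algebra) series2) \<Rightarrow> 'x list \<Rightarrow> ('x, 'a) series2" where
  "word_hom d [] = tens (ser_word []) (ser_word [])"
| "word_hom d (x # w) = ser2_mult (d x) (word_hom d w)"

definition cont_ext ::
  "('x list \<Rightarrow> 'k \<Rightarrow> 'a :: comm_rat_algebra) \<Rightarrow> ('x, 'a) series \<Rightarrow> 'k \<Rightarrow> 'a" where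
  "cont_ext L F = (\<lambda>v. \<Sum>w | L w v \<noteq> 0. F w * L w v)"

definition delta_sh_letter :: "'x \<Rightarrow> ('x, 'a :: comm_rat_algebra) series2" where
  "delta_sh_letter x = (\<lambda>p.
     tens (ser_word [x]) (ser_word []) p + tens (ser_word []) (ser_word [x]) p)"

definition delta_sh ::
  "('g xletter, 'a :: comm_rat_algebra) series \<Rightarrow> ('g xletter, 'a) series2" where
  "delta_sh = cont_ext (word_hom delta_sh_letter)"

text \<open>With $n = m + 1$ and $k = j + 1$, the letter $y_{n-k, g h^{-1}}$ is \<open>Y (m - 1 - j) (g - h)\<close>.\<close>

fun delta_harm_letter ::
  "'g :: {finite, ab_group_add} yletter \<Rightarrow> ('g yletter, 'a :: comm_rat_algebra) series2" where
  "delta_harm_letter (Y m g) = (\<lambda>p.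
     tens (ser_word [Y m g]) (ser_word []) p + tens (ser_word []) (ser_word [Y m g]) p
     + (\<Sum>j<m. \<Sum>h\<in>UNIV. tens (ser_word [Y j h]) (ser_word [Y (m - 1 - j) (g - h)]) p))"

definition delta_harm ::
  "('g :: {finite, ab_group_add} yletter, 'a :: comm_rat_algebra) series \<Rightarrow>
   ('g yletter, 'a) series2" where
  "delta_harm = cont_ext (word_hom delta_harm_letter)"

definition q_ser ::
  "('g :: {finite, ab_group_add} xletter, 'a :: comm_rat_algebra) series \<Rightarrow>
   ('g xletter, 'a) series" where
  "q_ser = cont_ext (\<lambda>w. ser_word (q_word w))"

text \<open>
  The projection onto the series in the letters \<open>Y m g\<close>, which discards the words ending in \<open>X0\<close>
  and rewrites the remaining ones as words in the \<open>Y m g\<close>.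
\<close>

definition pi_Y :: "('g xletter, 'a) series \<Rightarrow> ('g yletter, 'a) series" where
  "pi_Y F = (\<lambda>w. F (y_word w))"

text \<open>
  Here $x_1 = y_{1,1}$ is \<open>Y 0 0\<close>, and a word of length \<open>n\<close> is a power of it iff it equals
  \<open>replicate n (Y 0 0)\<close>.
\<close>

definition Phi_corr ::
  "('g :: {finite, ab_group_add} xletter, 'a :: comm_rat_algebra) series \<Rightarrow>
   ('g yletter, 'a) series" where
  "Phi_corr F = ser_exp (\<lambda>w. let n = length w in
     if n \<ge> 2 \<and> w = replicate n (Y 0 0)
     then ((-1) ^ (n - 1) / of_nat n) *\<^sub>Q F (replicate (n - 1) X0 @ [X 0]) else 0)"

definition Phi_star ::
  "('g :: {finite, ab_group_add} xletter, 'a :: comm_rat_algebra) series \<Rightarrow>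
   ('g yletter, 'a) series" where
  "Phi_star F = ser_mult (Phi_corr F) (pi_Y (q_ser F))"

definition DMR ::
  "('g :: {finite, ab_group_add} xletter, 'a :: comm_rat_algebra) series set" where
  "DMR = {F. F [X0] = 0 \<and> F [X 0] = 0 \<and>
     delta_sh F = tens F F \<and> F [] = 1 \<and>
     delta_harm (Phi_star F) = tens (Phi_star F) (Phi_star F)}"

definition Phi_reg ::
  "('g :: {finite, ab_group_add} H \<Rightarrow> 'a :: comm_rat_algebra) \<Rightarrow> ('g xletter, 'a) series" where
  "Phi_reg Z = (\<lambda>w. Z (reg (word w)))"

end

theory Submission
  imports Defs
begin

text \<open>
  Write \<open>\<partial>\<close> for the map removing a leading \<open>X 0\<close> from a word and \<open>D\<close> for the map removing a trailing
  \<open>X0\<close>; both send the words without such a letter to zero. They are commuting, locally nilpotent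
  derivations of the shuffle algebra, \<open>H0\<close> is the intersection of their kernels, and \<open>X 0\<close> and \<open>X0\<close>
  are slices: \<open>\<partial>\<close> maps \<open>X 0\<close> to \<open>1\<close>, and \<open>D\<close> maps \<open>X0\<close> to \<open>1\<close>. A locally nilpotent derivation \<open>d\<close> of
  a commutative rational algebra with slice \<open>s\<close> comes with an algebra endomorphism
  \<open>a \<mapsto> \<Sum>\<^sub>n (- s)\<^sup>n d\<^sup>n a / n!\<close> that projects onto the kernel of \<open>d\<close> and kills \<open>s\<close> (\<open>dix_sh\<close>, \<open>d_dix\<close>,
  \<open>dix_kernel\<close>, \<open>dix_slice\<close>), and the kernel and the slice generate the algebra (\<open>generate\<close>). Composing
  the projections for \<open>D\<close> and \<open>\<partial>\<close> gives \<open>reg\<close>, and \<open>regT p = \<Sum>\<^sub>n reg (\<partial>\<^sup>n p) T\<^sup>n / n!\<close>.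

  The coproducts are dual to the products, so that a series is group-like iff its linear extension to
  the free algebra is multiplicative (\<open>delta_sh_grouplike_iff\<close>, \<open>delta_harm_grouplike_iff\<close>). Thus the
  shuffle condition on \<open>F\<close> and the vanishing of \<open>F\<close> at \<open>X0\<close> and \<open>X 0\<close> say that \<open>lin_ext F\<close> is an
  algebra homomorphism killing both slices. Such a homomorphism is unchanged by composition with \<open>reg\<close>
  (\<open>hom_dix\<close>), hence it is the same as a homomorphism on \<open>H0\<close>; the inverse of \<open>Phi_reg\<close> is
  the restriction of \<open>lin_ext F\<close> to \<open>H0\<close>.

  The two harmonic conditions agree as well. The map \<open>rho Z\<close> is the power series \<open>rho_series Z\<close>
  evaluated at \<open>d/dT\<close>, so its inverse is the inverse series, whose coefficients are those of
  \<open>Phi_corr\<close>. The harmonic counterpart of \<open>\<partial>\<close>, which removes a leading \<open>Y 0 0\<close> and is again denoted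
  \<open>\<partial>\<close>, is a derivation of the harmonic product, because \<open>Y 0 0\<close> is not of the form
  \<open>Y (m + n + 1) g\<close>. It follows that the map that is required to be a homomorphism in \<open>EDS\<close> is
  \<open>a \<mapsto> \<Sum>\<^sub>n \<psi> (\<partial>\<^sup>n a) T\<^sup>n / n!\<close>, where \<open>\<psi>\<close> is the linear extension of \<open>Phi_star\<close>
  (\<open>coeff_harm_map\<close>). By the Leibniz rule it is multiplicative iff its constant term \<open>\<psi>\<close> is
  (\<open>alg_hom_harm_iff\<close>), which is the harmonic condition in \<open>DMR\<close>.
\<close>

section \<open>Rational linear maps\<close>

abbreviation linQ :: "('v :: rat_module \<Rightarrow> 'w :: rat_module) \<Rightarrow> bool" where
  "linQ \<equiv> linearQ_on UNIV"

lemma scaleQ_zero_left [simp]: "0 *\<^sub>Q (x :: 'a :: rat_module) = 0"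
  using scaleQ_add_left[of 0 0 x] by simp

declare scaleQ_one [simp] scaleQ_zero_right [simp] scaleQ_scaleQ [simp]

lemma scaleQ_minus_left: "(- r) *\<^sub>Q (x :: 'a :: rat_module) = - (r *\<^sub>Q x)"
  using scaleQ_add_left[of r "- r" x] by (simp add: eq_neg_iff_add_eq_0 add.commute)

lemma scaleQ_sum_right: "r *\<^sub>Q (\<Sum>i\<in>A. f i :: 'a :: rat_module) = (\<Sum>i\<in>A. r *\<^sub>Q f i)"
  by (induction A rule: infinite_finite_induct) (simp_all add: scaleQ_add_right)

lemma scaleQ_sum_left: "(\<Sum>i\<in>A. f i) *\<^sub>Q (x :: 'a :: rat_module) = (\<Sum>i\<in>A. f i *\<^sub>Q x)"
  by (induction A rule: infinite_finite_induct) (simp_all add: scaleQ_add_left)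

lemma scaleQ_mult_right: "(x :: 'a :: comm_rat_algebra) * (r *\<^sub>Q y) = r *\<^sub>Q (x * y)"
  by (metis mult.commute scaleQ_mult_left)

lemma linQI:
  assumes "\<And>p q. f (p + q) = f p + f q" and "\<And>r p. f (r *\<^sub>Q p) = r *\<^sub>Q f p"
  shows "linQ f"
  using assms by (simp add: linearQ_on_def)

lemma linQ_add: "linQ f \<Longrightarrow> f (p + q) = f p + f q"
  by (simp add: linearQ_on_def)

lemma linQ_scale: "linQ f \<Longrightarrow> f (r *\<^sub>Q p) = r *\<^sub>Q f p"
  by (simp add: linearQ_on_def)

lemma linQ_0: "linQ f \<Longrightarrow> f 0 = 0"
  using linQ_scale[of f 0 0] by simp

lemma linQ_sum: "linQ f \<Longrightarrow> f (\<Sum>i\<in>A. g i) = (\<Sum>i\<in>A. f (g i))"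
  by (induction A rule: infinite_finite_induct) (simp_all add: linQ_0 linQ_add)

lemma linQ_ident: "linQ (\<lambda>x. x)"
  by (rule linQI) simp_all

lemma linQ_zero: "linQ (\<lambda>x. 0)"
  by (rule linQI) simp_all

lemma linQ_compose: "linQ f \<Longrightarrow> linQ g \<Longrightarrow> linQ (\<lambda>x. f (g x))"
  by (rule linQI) (simp_all add: linQ_add linQ_scale)

lemma linQ_scaled: "linQ f \<Longrightarrow> linQ (\<lambda>x. r *\<^sub>Q f x)"
  by (rule linQI) (simp_all add: linQ_add linQ_scale scaleQ_add_right mult.commute)

lemma linQ_summed: "(\<And>i. linQ (f i)) \<Longrightarrow> linQ (\<lambda>x. \<Sum>i\<in>A. f i x)"
  by (rule linQI) (simp_all add: linQ_add linQ_scale sum.distrib scaleQ_sum_right)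

lemma linQ_funpow: "linQ d \<Longrightarrow> linQ (d ^^ n)" for d :: "'v :: rat_module \<Rightarrow> 'v"
  by (induction n) (simp_all add: comp_def id_def linQ_ident linQ_compose[where f = d])

lemma linQ_times: "linQ f \<Longrightarrow> linQ (\<lambda>x. f x * (c :: 'a :: comm_rat_algebra))"
  by (rule linQI) (simp_all add: linQ_add linQ_scale distrib_right scaleQ_mult_left)

lemma funpow_zero_mono:
  fixes d :: "'v :: rat_module \<Rightarrow> 'v"
  assumes "linQ d" and "(d ^^ N) a = 0" and "N \<le> n"
  shows "(d ^^ n) a = 0"
proof -
  have "(d ^^ n) a = (d ^^ (n - N)) ((d ^^ N) a)"
    using assms(3) funpow_add[of "n - N" N d] by simp
  then show ?thesis using assms(2) by (simp add: linQ_0[OF linQ_funpow[OF assms(1)]])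
qed

lemma sum_square_triangle:
  fixes t :: "nat \<Rightarrow> nat \<Rightarrow> 'a :: comm_monoid_add"
  assumes "\<And>k l. k + l > N \<Longrightarrow> t k l = 0"
  shows "(\<Sum>k\<le>N. \<Sum>l\<le>N. t k l) = (\<Sum>n\<le>N. \<Sum>k\<le>n. t k (n - k))"
proof -
  have "(\<Sum>k\<le>N. \<Sum>l\<le>N. t k l) = (\<Sum>(k, l)\<in>{..N} \<times> {..N}. t k l)"
    by (rule sum.cartesian_product)
  also have "\<dots> = (\<Sum>(k, l)\<in>{(k, l). k + l \<le> N}. t k l)"
    by (rule sum.mono_neutral_right) (auto intro!: assms)
  finally show ?thesis by (simp add: sum.triangle_reindex_eq)
qed

section \<open>Linear extension from words\<close>

lemma lookup_word: "Poly_Mapping.lookup (word w) v = (if v = w then 1 else 0)"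
  by (simp add: word_def lookup_single when_def)

lemma linQ_lookup: "linQ (\<lambda>p :: 'x falg. Poly_Mapping.lookup p w)"
  by (rule linQI) (simp_all add: lookup_add lookup_scaleQ)

lemma lin_ext_superset:
  fixes p :: "'x falg"
  assumes "finite A" and "Poly_Mapping.keys p \<subseteq> A"
  shows "lin_ext f p = (\<Sum>w\<in>A. Poly_Mapping.lookup p w *\<^sub>Q f w)"
  unfolding lin_ext_def
  by (rule sum.mono_neutral_left) (use assms in \<open>auto simp: in_keys_iff\<close>)

lemma linQ_lin_ext: "linQ (lin_ext f)"
proof (rule linQI)
  fix p q :: "'a falg" and r
  let ?A = "Poly_Mapping.keys p \<union> Poly_Mapping.keys q"
  have "Poly_Mapping.keys (p + q) \<subseteq> ?A" by (rule Poly_Mapping.keys_add)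
  then show "lin_ext f (p + q) = lin_ext f p + lin_ext f q"
    by (simp add: lin_ext_superset[of ?A] lookup_add scaleQ_add_left sum.distrib)
  have "Poly_Mapping.keys (r *\<^sub>Q p) \<subseteq> Poly_Mapping.keys p"
    by (auto simp: in_keys_iff lookup_scaleQ)
  then show "lin_ext f (r *\<^sub>Q p) = r *\<^sub>Q lin_ext f p"
    by (simp add: lin_ext_superset[of "Poly_Mapping.keys p"] lookup_scaleQ scaleQ_sum_right
        scaleQ_rat_def)
qed

lemma lin_ext_word [simp]: "lin_ext f (word w) = f w"
  by (subst lin_ext_superset[of "{w}"]) (auto simp: lookup_word in_keys_iff split: if_splits)

lemma lin_ext_word_id: "lin_ext word p = p"
proof (rule poly_mapping_eqI)
  fix v
  have "Poly_Mapping.lookup (lin_ext word p) v =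
      (\<Sum>w\<in>Poly_Mapping.keys p. Poly_Mapping.lookup p w * (if v = w then 1 else 0))"
    unfolding lin_ext_def linQ_sum[OF linQ_lookup]
    by (rule sum.cong) (simp_all add: lookup_scaleQ scaleQ_rat_def lookup_word)
  also have "\<dots> = Poly_Mapping.lookup p v"
    by (simp add: in_keys_iff if_distrib[of "(*) _"] cong: if_cong)
  finally show "Poly_Mapping.lookup (lin_ext word p) v = Poly_Mapping.lookup p v" .
qed

lemma linQ_eq_lin_ext: "linQ g \<Longrightarrow> g p = lin_ext (\<lambda>w. g (word w)) p"
  by (subst lin_ext_word_id[of p, symmetric]) (simp add: lin_ext_def linQ_sum linQ_scale)

lemma linQ_eqI:
  assumes "linQ f" and "linQ g" and "\<And>w. f (word w) = g (word w)"
  shows "f p = g p"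
  by (simp add: linQ_eq_lin_ext[OF assms(1), of p] linQ_eq_lin_ext[OF assms(2), of p] assms(3))

lemma bilin_ext_linear_left: "linQ (\<lambda>p. bilin_ext f p q)"
  unfolding bilin_ext_def by (rule linQ_lin_ext)

lemma bilin_ext_linear_right: "linQ (bilin_ext f p)"
  unfolding bilin_ext_def lin_ext_def[of _ p]
  by (intro linQ_summed linQ_scaled linQ_lin_ext)

lemma bilin_ext_word [simp]: "bilin_ext f (word u) (word v) = f u v"
  by (simp add: bilin_ext_def)

lemma bilin_eqI:
  assumes "\<And>q. linQ (\<lambda>p. f p q)" and "\<And>p. linQ (f p)"
    and "\<And>q. linQ (\<lambda>p. g p q)" and "\<And>p. linQ (g p)"
    and "\<And>u v. f (word u) (word v) = g (word u) (word v)"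
  shows "f p q = g p q"
  by (rule linQ_eqI[of "\<lambda>p. f p q" "\<lambda>p. g p q"], rule assms, rule assms,
      rule linQ_eqI[of "f _" "g _"]) (rule assms)+

section \<open>Removing outer letters\<close>

text \<open>\<open>ldel x\<close> sends \<open>x w\<close> to \<open>w\<close> and all other words to zero; \<open>rdel x\<close> does so on the right.\<close>

definition ldel :: "'x \<Rightarrow> 'x falg \<Rightarrow> 'x falg" where
  "ldel x = Poly_Mapping.map_key (Cons x)"

definition rdel :: "'x \<Rightarrow> 'x falg \<Rightarrow> 'x falg" where
  "rdel x = Poly_Mapping.map_key (\<lambda>w. w @ [x])"

lemma lookup_ldel: "Poly_Mapping.lookup (ldel x p) w = Poly_Mapping.lookup p (x # w)"
  by (simp add: ldel_def map_key.rep_eq)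

lemma lookup_rdel: "Poly_Mapping.lookup (rdel x p) w = Poly_Mapping.lookup p (w @ [x])"
  by (simp add: rdel_def map_key.rep_eq inj_def)

lemma linQ_ldel: "linQ (ldel x)"
  by (rule linQI; rule poly_mapping_eqI) (simp_all add: lookup_ldel lookup_add lookup_scaleQ)

lemma linQ_rdel: "linQ (rdel x)"
  by (rule linQI; rule poly_mapping_eqI) (simp_all add: lookup_rdel lookup_add lookup_scaleQ)

lemma ldel_rdel: "ldel x (rdel y p) = rdel y (ldel x p)"
  by (rule poly_mapping_eqI) (simp add: lookup_ldel lookup_rdel)

lemma ldel_word [simp]:
  "ldel x (word []) = 0" "ldel x (word (y # w)) = (if x = y then word w else 0)"
  by (rule poly_mapping_eqI; simp add: lookup_ldel lookup_word)+

lemma rdel_word [simp]: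
  "rdel x (word []) = 0" "rdel x (word (w @ [y])) = (if x = y then word w else 0)"
  by (rule poly_mapping_eqI; simp add: lookup_rdel lookup_word)+

lemma rdel_word_single [simp]: "rdel x (word [y]) = (if x = y then word [] else 0)"
  using rdel_word(2)[of x "[]" y] by simp

lemma falg_eqI_left:
  assumes "Poly_Mapping.lookup p [] = Poly_Mapping.lookup q []" and "\<And>x. ldel x p = ldel x q"
  shows "p = q"
proof (rule poly_mapping_eqI)
  fix w show "Poly_Mapping.lookup p w = Poly_Mapping.lookup q w"
    by (cases w) (use assms in \<open>simp_all flip: lookup_ldel\<close>)
qed

lemma falg_eqI_right:
  assumes "Poly_Mapping.lookup p [] = Poly_Mapping.lookup q []" and "\<And>x. rdel x p = rdel x q"
  shows "p = q"
proof (rule poly_mapping_eqI)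
  fix w show "Poly_Mapping.lookup p w = Poly_Mapping.lookup q w"
    by (cases w rule: rev_cases) (use assms in \<open>simp_all flip: lookup_rdel\<close>)
qed

lemma linQ_conc_left: "linQ (\<lambda>p. p \<odot> q)" and linQ_conc_right: "linQ (\<lambda>q. p \<odot> q)"
  by (simp_all add: conc_def bilin_ext_linear_left bilin_ext_linear_right)

lemma conc_word [simp]: "word u \<odot> word v = word (u @ v)"
  by (simp add: conc_def)

lemma ldel_conc: "ldel x (word [y] \<odot> p) = (if x = y then p else 0)"
  using linQ_eqI[where f = "\<lambda>p. ldel x (word [y] \<odot> p)" and g = "\<lambda>p. if x = y then p else 0" and p = p]
  by (cases "x = y") (simp_all add: linQ_compose[OF linQ_ldel] linQ_conc_right linQ_ident linQ_zero)

lemma rdel_conc: "rdel x (p \<odot> word [y]) = (if x = y then p else 0)"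
  using linQ_eqI[where f = "\<lambda>p. rdel x (p \<odot> word [y])" and g = "\<lambda>p. if x = y then p else 0" and p = p]
  by (cases "x = y") (simp_all add: linQ_compose[OF linQ_rdel] linQ_conc_left linQ_ident linQ_zero)

lemma lookup_conc_Nil:
  "Poly_Mapping.lookup (word [y] \<odot> p) [] = 0" "Poly_Mapping.lookup (p \<odot> word [y]) [] = 0"
  using linQ_eqI[where f = "\<lambda>p. Poly_Mapping.lookup (word [y] \<odot> p) []" and g = "\<lambda>p. 0" and p = p]
    linQ_eqI[where f = "\<lambda>p. Poly_Mapping.lookup (p \<odot> word [y]) []" and g = "\<lambda>p. 0" and p = p]
  by (simp_all add: linQ_compose[OF linQ_lookup] linQ_conc_right linQ_conc_left linQ_zero lookup_word)

lemma lookup_ldel_pow: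
  "Poly_Mapping.lookup ((ldel x ^^ n) p) w = Poly_Mapping.lookup p (replicate n x @ w)"
  by (induction n arbitrary: p w) (simp_all add: lookup_ldel replicate_app_Cons_same)

lemma lookup_rdel_pow:
  "Poly_Mapping.lookup ((rdel x ^^ n) p) w = Poly_Mapping.lookup p (w @ replicate n x)"
  by (induction n arbitrary: p w) (simp_all add: lookup_rdel)

lemma lookup_long_word:
  fixes p :: "'x falg"
  obtains N where "\<And>w. length w \<ge> N \<Longrightarrow> Poly_Mapping.lookup p w = 0"
proof
  fix w :: "'x list"
  assume w: "length w \<ge> Suc (\<Sum>v\<in>Poly_Mapping.keys p. length v)"
  show "Poly_Mapping.lookup p w = 0"
  proof (rule ccontr)
    assume "Poly_Mapping.lookup p w \<noteq> 0"
    then have "length w \<le> (\<Sum>v\<in>Poly_Mapping.keys p. length v)"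
      by (intro member_le_sum) (auto simp: in_keys_iff)
    then show False using w by simp
  qed
qed

lemma ldel_nilpotent: "\<exists>N. (ldel x ^^ N) p = 0"
proof -
  obtain N where N: "\<And>w. length w \<ge> N \<Longrightarrow> Poly_Mapping.lookup p w = 0"
    using lookup_long_word by blast
  have "(ldel x ^^ N) p = 0"
    by (rule poly_mapping_eqI) (simp add: lookup_ldel_pow N)
  then show ?thesis ..
qed

lemma rdel_nilpotent: "\<exists>N. (rdel x ^^ N) p = 0"
proof -
  obtain N where N: "\<And>w. length w \<ge> N \<Longrightarrow> Poly_Mapping.lookup p w = 0"
    using lookup_long_word by blast
  have "(rdel x ^^ N) p = 0"
    by (rule poly_mapping_eqI) (simp add: lookup_rdel_pow N)
  then show ?thesis ..
qed

section \<open>The shuffle algebra\<close>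

lemma linQ_sh_left: "linQ (\<lambda>p. sh p q)" and linQ_sh_right: "linQ (sh p)"
  by (simp_all add: sh_def bilin_ext_linear_left bilin_ext_linear_right)

lemma sh_word_eq [simp]: "sh (word u) (word v) = sh_word u v"
  by (simp add: sh_def)

lemma sh_word_Nil_right [simp]: "sh_word w [] = word w"
  by (cases w) simp_all

lemma sh_zero [simp]: "sh 0 q = 0" "sh p 0 = 0"
  using linQ_0[OF linQ_sh_left] linQ_0[OF linQ_sh_right] by auto

lemmas sh_add_left = linQ_add[OF linQ_sh_left]
  and sh_add_right = linQ_add[OF linQ_sh_right]
  and sh_scale_left = linQ_scale[OF linQ_sh_left]
  and sh_scale_right = linQ_scale[OF linQ_sh_right]
  and sh_sum_left = linQ_sum[OF linQ_sh_left]
  and sh_sum_right = linQ_sum[OF linQ_sh_right]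

lemma sh_one_left [simp]: "sh (word []) p = p"
  by (rule linQ_eqI[where p = p]) (simp_all add: linQ_sh_right linQ_ident)

lemma sh_one_right [simp]: "sh p (word []) = p"
  by (rule linQ_eqI[where p = p]) (simp_all add: linQ_sh_left linQ_ident)

lemma lookup_sh_Nil:
  "Poly_Mapping.lookup (sh p q) [] = Poly_Mapping.lookup p [] * Poly_Mapping.lookup q []"
proof (rule bilin_eqI[where f = "\<lambda>p q. Poly_Mapping.lookup (sh p q) []"
      and g = "\<lambda>p q. Poly_Mapping.lookup p [] * Poly_Mapping.lookup q []"])
  show "Poly_Mapping.lookup (sh (word u) (word v)) [] =
      Poly_Mapping.lookup (word u) [] * Poly_Mapping.lookup (word v) []" for u v :: "'a list"
    by (cases u; cases v) (auto simp: lookup_word lookup_add lookup_conc_Nil)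
qed (rule linQI; simp add: sh_add_left sh_add_right sh_scale_left sh_scale_right lookup_add
    lookup_scaleQ scaleQ_rat_def distrib_left distrib_right mult.left_commute)+

lemma ldel_sh: "ldel x (sh p q) = sh (ldel x p) q + sh p (ldel x q)"
proof (rule bilin_eqI[where f = "\<lambda>p q. ldel x (sh p q)"
      and g = "\<lambda>p q. sh (ldel x p) q + sh p (ldel x q)"])
  show "ldel x (sh (word u) (word v)) = sh (ldel x (word u)) (word v) + sh (word u) (ldel x (word v))"
    for u v
    by (cases u; cases v) (auto simp: linQ_add[OF linQ_ldel] ldel_conc)
qed (rule linQI; simp add: sh_add_left sh_add_right sh_scale_left sh_scale_right scaleQ_add_right
    linQ_add[OF linQ_ldel] linQ_scale[OF linQ_ldel])+

text \<open>
  Identities in the shuffle algebra follow coefficient by coefficient: the coefficient at \<open>x # w\<close>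
  is the one at \<open>w\<close> of the image under the derivation \<open>ldel x\<close>.
\<close>

lemma sh_commute: "sh p q = sh q p"
proof (rule poly_mapping_eqI)
  fix w show "Poly_Mapping.lookup (sh p q) w = Poly_Mapping.lookup (sh q p) w"
  proof (induction w arbitrary: p q)
    case Nil
    show ?case by (simp add: lookup_sh_Nil)
  next
    case (Cons x w)
    have "Poly_Mapping.lookup (sh p q) (x # w) =
        Poly_Mapping.lookup (sh (ldel x p) q) w + Poly_Mapping.lookup (sh p (ldel x q)) w"
      by (simp add: ldel_sh lookup_add flip: lookup_ldel)
    also have "\<dots> = Poly_Mapping.lookup (sh (ldel x q) p) w + Poly_Mapping.lookup (sh q (ldel x p)) w"
      by (simp only: Cons[of "ldel x p" q] Cons[of p "ldel x q"] add.commute)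
    also have "\<dots> = Poly_Mapping.lookup (sh q p) (x # w)"
      by (simp add: ldel_sh lookup_add flip: lookup_ldel)
    finally show ?case .
  qed
qed

lemma sh_assoc: "sh (sh p q) r = sh p (sh q r)"
proof (rule poly_mapping_eqI)
  fix w show "Poly_Mapping.lookup (sh (sh p q) r) w = Poly_Mapping.lookup (sh p (sh q r)) w"
    by (induction w arbitrary: p q r)
      (simp_all add: lookup_sh_Nil lookup_add ldel_sh sh_add_left sh_add_right mult.assoc
        flip: lookup_ldel)
qed

lemma rdel_sh: "rdel x (sh p q) = sh (rdel x p) q + sh p (rdel x q)"
proof (rule poly_mapping_eqI)
  have Nil': "Poly_Mapping.lookup (rdel x p) [] = Poly_Mapping.lookup (ldel x p) []" for p
    by (simp add: lookup_rdel lookup_ldel)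
  fix w show "Poly_Mapping.lookup (rdel x (sh p q)) w =
      Poly_Mapping.lookup (sh (rdel x p) q + sh p (rdel x q)) w"
  proof (induction w arbitrary: p q)
    case Nil
    show ?case by (simp add: Nil' ldel_sh lookup_add lookup_sh_Nil)
  next
    case (Cons y w)
    show ?case
      by (simp add: Cons ldel_sh ldel_rdel lookup_add linQ_add[OF linQ_rdel] linQ_add[OF linQ_ldel]
          flip: lookup_ldel)
  qed
qed

interpretation sh: abel_semigroup sh
  by unfold_locales (rule sh_assoc, rule sh_commute)

section \<open>Divided powers and slices of a derivation\<close>

text \<open>The divided powers \<open>d\<^sup>n / n!\<close> turn the iterated Leibniz rule into a convolution.\<close>

definition dpow :: "('v :: rat_module \<Rightarrow> 'v) \<Rightarrow> nat \<Rightarrow> 'v \<Rightarrow> 'v" where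
  "dpow d n a = (1 / fact n) *\<^sub>Q (d ^^ n) a"

lemma linQ_dpow: "linQ d \<Longrightarrow> linQ (dpow d n)"
  unfolding dpow_def by (intro linQ_scaled linQ_funpow)

lemma funpow_eq_dpow: "(d ^^ n) a = fact n *\<^sub>Q dpow d n a"
  by (simp add: dpow_def)

lemma dpow_0 [simp]: "dpow d 0 a = a"
  by (simp add: dpow_def)

lemma apply_dpow: "linQ d \<Longrightarrow> d (dpow d n a) = of_nat (Suc n) *\<^sub>Q dpow d (Suc n) a"
  by (simp add: dpow_def linQ_scale del: of_nat_Suc)

lemma dpow_leibniz:
  fixes d :: "'v :: rat_module \<Rightarrow> 'v" and m :: "'v \<Rightarrow> 'v \<Rightarrow> 'v"
  assumes d: "linQ d" and l: "\<And>q. linQ (\<lambda>p. m p q)" and r: "\<And>p. linQ (m p)"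
    and deriv: "\<And>p q. d (m p q) = m (d p) q + m p (d q)"
  shows "dpow d n (m p q) = (\<Sum>i\<le>n. m (dpow d i p) (dpow d (n - i) q))"
proof (induction n)
  case 0
  show ?case by simp
next
  case (Suc n)
  define t where "t i = m (dpow d i p) (dpow d (Suc n - i) q)" for i
  have "of_nat (Suc n) *\<^sub>Q dpow d (Suc n) (m p q) = d (\<Sum>i\<le>n. m (dpow d i p) (dpow d (n - i) q))"
    by (simp only: Suc apply_dpow[OF d, symmetric])
  also have "\<dots> = (\<Sum>i\<le>n. of_nat (Suc i) *\<^sub>Q t (Suc i)) + (\<Sum>i\<le>n. of_nat (Suc n - i) *\<^sub>Q t i)"
    unfolding linQ_sum[OF d] deriv sum.distrib t_def
    by (intro arg_cong2[where f = plus] sum.cong refl)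
      (simp_all add: apply_dpow[OF d] linQ_scale[OF l] linQ_scale[OF r] Suc_diff_le del: of_nat_Suc)
  also have "(\<Sum>i\<le>n. of_nat (Suc i) *\<^sub>Q t (Suc i)) = (\<Sum>i\<le>Suc n. of_nat i *\<^sub>Q t i)"
    by (subst sum.atMost_Suc_shift) simp
  also have "(\<Sum>i\<le>n. of_nat (Suc n - i) *\<^sub>Q t i) = (\<Sum>i\<le>Suc n. of_nat (Suc n - i) *\<^sub>Q t i)"
    by simp
  also have "(\<Sum>i\<le>Suc n. of_nat i *\<^sub>Q t i) + (\<Sum>i\<le>Suc n. of_nat (Suc n - i) *\<^sub>Q t i)
      = of_nat (Suc n) *\<^sub>Q (\<Sum>i\<le>Suc n. t i)"
    unfolding sum.distrib[symmetric] scaleQ_sum_right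
    by (intro sum.cong refl) (simp flip: scaleQ_add_left of_nat_add del: of_nat_Suc)
  finally have "(1 / of_nat (Suc n)) *\<^sub>Q of_nat (Suc n) *\<^sub>Q dpow d (Suc n) (m p q)
      = (1 / of_nat (Suc n)) *\<^sub>Q of_nat (Suc n) *\<^sub>Q (\<Sum>i\<le>Suc n. t i)"
    by (rule arg_cong)
  then show ?case
    by (simp add: t_def del: of_nat_Suc sum.atMost_Suc)
qed

lemma dpow_eventually_0:
  fixes d :: "'v :: rat_module \<Rightarrow> 'v"
  assumes "linQ d" and "(d ^^ N) p = 0" and "n \<ge> N"
  shows "dpow d n p = 0"
  using funpow_zero_mono[OF assms] by (simp add: dpow_def)

lemma sh_word_replicate:
  "sh_word (replicate i x) (replicate j x) = of_nat ((i + j) choose i) *\<^sub>Q word (replicate (i + j) x)"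
proof (induction i arbitrary: j)
  case 0
  show ?case by simp
next
  case (Suc i)
  note IH = Suc
  show ?case
  proof (induction j)
    case 0
    show ?case by simp
  next
    case (Suc j)
    have "sh_word (replicate (Suc i) x) (replicate (Suc j) x) =
        word [x] \<odot> (of_nat ((i + Suc j) choose i) *\<^sub>Q word (replicate (i + Suc j) x))
        + word [x] \<odot> (of_nat ((Suc i + j) choose Suc i) *\<^sub>Q word (replicate (Suc i + j) x))"
      using IH[of "Suc j"] Suc by simp
    then show ?case
      by (simp add: linQ_scale[OF linQ_conc_right] flip: scaleQ_add_left of_nat_add)
  qed
qed

text \<open>
  A locally nilpotent derivation \<open>d\<close> of the shuffle algebra with slice \<open>x\<close>. As the \<open>n\<close>-th shuffle
  power of a letter \<open>x\<close> is \<open>n!\<close> times the word \<open>x\<^sup>n\<close>, this word is the divided power of the slice,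
  and \<open>d_pow\<close> is the corresponding form of \<open>d x = 1\<close>.
\<close>

locale sh_slice =
  fixes d :: "'x falg \<Rightarrow> 'x falg" and x :: 'x
  assumes linear: "linQ d"
    and d_sh: "d (sh p q) = sh (d p) q + sh p (d q)"
    and d_pow: "d (word (replicate (Suc n) x)) = word (replicate n x)"
    and nilpotent: "\<exists>N. (d ^^ N) p = 0"
begin

abbreviation s :: "nat \<Rightarrow> 'x falg" where
  "s n \<equiv> word (replicate n x)"

lemma d_one: "d (word []) = 0"
  using d_sh[of "word []" "word []"] by simp

lemma sh_s: "sh (s i) (s j) = of_nat ((i + j) choose i) *\<^sub>Q s (i + j)"
  by (simp add: sh_word_replicate)

lemma s_Suc: "s (Suc n) = (1 / of_nat (Suc n)) *\<^sub>Q sh (s 1) (s n)"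
  unfolding sh_s by (simp del: of_nat_Suc)

lemma common_order:
  obtains N where "(d ^^ N) p = 0" and "(d ^^ N) q = 0"
proof -
  obtain M N where "(d ^^ M) p = 0" "(d ^^ N) q = 0" using nilpotent by blast
  then show ?thesis
    using that[of "max M N"] funpow_zero_mono[OF linear, of M p "max M N"]
      funpow_zero_mono[OF linear, of N q "max M N"] by simp
qed

text \<open>
  The projection \<open>a \<mapsto> \<Sum>\<^sub>n (- x)\<^sup>n d\<^sup>n a / n!\<close> onto the kernel of \<open>d\<close> (the Dixmier map), the
  divided powers of the slice \<open>x\<close> being written as words.
\<close>

definition dix :: "'x falg \<Rightarrow> 'x falg" where
  "dix a = (\<Sum>n | (d ^^ n) a \<noteq> 0. (- 1) ^ n *\<^sub>Q sh (s n) ((d ^^ n) a))"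

lemma dix_eq:
  assumes "(d ^^ N) a = 0"
  shows "dix a = (\<Sum>n\<le>N. (- 1) ^ n *\<^sub>Q sh (s n) ((d ^^ n) a))"
  unfolding dix_def
proof (rule sum.mono_neutral_left)
  show "{n. (d ^^ n) a \<noteq> 0} \<subseteq> {..N}"
    using funpow_zero_mono[OF linear assms] by (auto intro: leI less_imp_le)
qed auto

lemma linQ_dix: "linQ dix"
proof (rule linQI)
  fix p q r
  obtain N where N: "(d ^^ N) p = 0" "(d ^^ N) q = 0" by (rule common_order)
  note pow = linQ_add[OF linQ_funpow[OF linear]] linQ_scale[OF linQ_funpow[OF linear]]
  show "dix (p + q) = dix p + dix q" "dix (r *\<^sub>Q p) = r *\<^sub>Q dix p"
    using N by (simp_all add: dix_eq[of N] pow sh_add_right sh_scale_right scaleQ_add_right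
        sum.distrib scaleQ_sum_right mult.commute)
qed

lemma dix_kernel: "d a = 0 \<Longrightarrow> dix a = a"
  by (subst dix_eq[of 1]) simp_all

lemma dix_slice: "dix (s 1) = 0"
proof -
  have [simp]: "d (word [x]) = word []" using d_pow[of 0] by simp
  show ?thesis
    by (subst dix_eq[of 2]) (simp_all add: numeral_2_eq_2 d_one scaleQ_minus_left)
qed

lemma d_dix: "d (dix a) = 0"
proof -
  obtain N where N: "(d ^^ N) a = 0" using nilpotent by blast
  \<comment> \<open>The sum telescopes: only the term in which \<open>d\<close> is applied \<open>M + 1\<close> times to \<open>a\<close> survives.\<close>
  have "d (\<Sum>n\<le>M. (- 1) ^ n *\<^sub>Q sh (s n) ((d ^^ n) a)) = (- 1) ^ M *\<^sub>Q sh (s M) ((d ^^ Suc M) a)" for M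
  proof (induction M)
    case 0
    show ?case by (simp add: linQ_scale[OF linear])
  next
    case (Suc M)
    show ?case
      by (simp only: sum.atMost_Suc linQ_add[OF linear] Suc linQ_scale[OF linear] d_sh d_pow)
        (simp add: scaleQ_add_right scaleQ_minus_left)
  qed
  then show ?thesis using N by (simp add: dix_eq[OF N] linQ_0[OF linear])
qed

lemma dix_sh: "dix (sh a b) = sh (dix a) (dix b)"
proof -
  obtain N where N: "(d ^^ N) a = 0" "(d ^^ N) b = 0" by (rule common_order)
  have zero: "(d ^^ n) a = 0" "(d ^^ n) b = 0" if "n \<ge> N" for n
    using that N funpow_zero_mono[OF linear] by blast+
  have zero': "dpow d n a = 0" "dpow d n b = 0" if "n \<ge> N" for n
    using zero[OF that] by (simp_all add: dpow_def)
  \<comment> \<open>A product of derivatives of \<open>a\<close> and \<open>b\<close> of total order \<open>2 N\<close> contains one of order at least \<open>N\<close>.\<close>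
  define M where "M = 2 * N"
  define t where "t i j = ((- 1) ^ (i + j) * fact (i + j)) *\<^sub>Q
    sh (s (i + j)) (sh (dpow d i a) (dpow d j b))" for i j
  have t_0: "t i j = 0" if "i + j > M" for i j
  proof -
    have "i \<ge> N \<or> j \<ge> N" using that by (auto simp: M_def)
    then show ?thesis by (auto simp: t_def zero')
  qed
  have binom: "of_nat ((i + j) choose i) * (fact i * fact j) = (fact (i + j) :: rat)" for i j
    by (simp add: binomial_fact)
  have "sh (dix a) (dix b) = (\<Sum>i\<le>M. \<Sum>j\<le>M. sh ((- 1) ^ i *\<^sub>Q sh (s i) ((d ^^ i) a))
      ((- 1) ^ j *\<^sub>Q sh (s j) ((d ^^ j) b)))"
    by (subst sum.swap) (simp add: dix_eq[of M] zero M_def sh_sum_left sh_sum_right)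
  also have "\<dots> = (\<Sum>i\<le>M. \<Sum>j\<le>M. t i j)"
  proof (intro sum.cong refl)
    fix i j
    have "sh (sh (s i) (dpow d i a)) (sh (s j) (dpow d j b))
        = sh (sh (s i) (s j)) (sh (dpow d i a) (dpow d j b))"
      by (simp only: sh.assoc sh.left_commute)
    then show "sh ((- 1) ^ i *\<^sub>Q sh (s i) ((d ^^ i) a)) ((- 1) ^ j *\<^sub>Q sh (s j) ((d ^^ j) b)) = t i j"
      by (simp only: t_def funpow_eq_dpow sh_s sh_scale_left sh_scale_right scaleQ_scaleQ
          binom[symmetric]) (simp add: power_add mult_ac)
  qed
  also have "\<dots> = (\<Sum>n\<le>M. \<Sum>i\<le>n. t i (n - i))"
    by (rule sum_square_triangle) (rule t_0)
  also have "\<dots> = (\<Sum>n\<le>M. (- 1) ^ n *\<^sub>Q sh (s n) ((d ^^ n) (sh a b)))"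
    by (intro sum.cong refl)
      (simp add: t_def funpow_eq_dpow sh_scale_right sh_sum_right scaleQ_sum_right
        dpow_leibniz[where m = sh, OF linear linQ_sh_left linQ_sh_right d_sh])
  also have "\<dots> = dix (sh a b)"
  proof (rule dix_eq[symmetric])
    have "sh (dpow d i a) (dpow d (M - i) b) = 0" for i
    proof -
      have "i \<ge> N \<or> M - i \<ge> N" by (auto simp: M_def)
      then show ?thesis by (auto simp: zero')
    qed
    then show "(d ^^ M) (sh a b) = 0"
      by (simp add: funpow_eq_dpow dpow_leibniz[where m = sh, OF linear linQ_sh_left linQ_sh_right d_sh])
  qed
  finally show ?thesis ..
qed

lemma dix_commute:
  assumes e: "linQ e" and e_sh: "\<And>p q. e (sh p q) = sh (e p) q + sh p (e q)"
    and e_s: "\<And>n. e (s n) = 0" and comm: "\<And>p. e (d p) = d (e p)"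
  shows "e (dix a) = dix (e a)"
proof -
  have pow: "e ((d ^^ n) a) = (d ^^ n) (e a)" for n
    by (induction n) (simp_all add: comm)
  obtain N where N: "(d ^^ N) a = 0" "(d ^^ N) (e a) = 0" by (rule common_order)
  then show ?thesis
    by (simp add: dix_eq[of N] linQ_sum[OF e] linQ_scale[OF e] e_sh e_s pow)
qed

text \<open>All terms of \<open>dix a\<close> but the first contain the slice as a factor.\<close>

lemma hom_dix:
  fixes \<phi> :: "'x falg \<Rightarrow> 'a :: comm_rat_algebra"
  assumes \<phi>: "linQ \<phi>" and mult: "\<And>p q. \<phi> (sh p q) = \<phi> p * \<phi> q" and s1: "\<phi> (s 1) = 0"
  shows "\<phi> (dix a) = \<phi> a"
proof -
  obtain N where N: "(d ^^ N) a = 0" using nilpotent by blast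
  have s: "\<phi> (s (Suc n)) = 0" for n
    by (simp only: s_Suc linQ_scale[OF \<phi>] mult s1) simp
  have "\<phi> (dix a) = (\<Sum>n\<le>N. (- 1) ^ n *\<^sub>Q \<phi> (sh (s n) ((d ^^ n) a)))"
    by (simp add: dix_eq[OF N] linQ_sum[OF \<phi>] linQ_scale[OF \<phi>])
  also have "\<dots> = (\<Sum>n\<le>N. if n = 0 then \<phi> a else 0)"
  proof (intro sum.cong refl)
    fix n
    show "(- 1) ^ n *\<^sub>Q \<phi> (sh (s n) ((d ^^ n) a)) = (if n = 0 then \<phi> a else 0)"
      by (cases n) (simp_all add: mult s del: replicate_Suc funpow.simps(2) power_Suc)
  qed
  finally show ?thesis by simp
qed

text \<open>
  Since \<open>dix a\<close> differs from \<open>a\<close> by products of divided powers of the slice with derivatives of \<open>a\<close>,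
  which have smaller order of nilpotency, a subalgebra that contains the slice and \<open>dix a\<close> for all
  \<open>a\<close> in a set \<open>K\<close> closed under \<open>d\<close> contains \<open>K\<close>.
\<close>

lemma generate:
  assumes add: "\<And>p q. p \<in> S \<Longrightarrow> q \<in> S \<Longrightarrow> p + q \<in> S" and scale: "\<And>r p. p \<in> S \<Longrightarrow> r *\<^sub>Q p \<in> S"
    and mult: "\<And>p q. p \<in> S \<Longrightarrow> q \<in> S \<Longrightarrow> sh p q \<in> S"
    and one: "word [] \<in> S" and slice: "s 1 \<in> S"
    and K: "\<And>p. p \<in> K \<Longrightarrow> d p \<in> K" "\<And>p. p \<in> K \<Longrightarrow> dix p \<in> S"
  shows "K \<subseteq> S"
proof -
  have zero: "0 \<in> S" using scale[OF one, of 0] by simp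
  have s: "s n \<in> S" for n
    by (induction n) (use one in simp, subst s_Suc, intro scale mult slice)
  have sum: "(\<Sum>n\<le>N. f n) \<in> S" if "\<And>n. f n \<in> S" for N :: nat and f
    by (induction N) (simp_all add: that add)
  have "a \<in> S" if "(d ^^ N) a = 0" "a \<in> K" for N a
    using that
  proof (induction N arbitrary: a)
    case 0
    then show ?case using zero by simp
  next
    case (Suc N)
    have pow: "(d ^^ n) (d a) \<in> S" for n
    proof (rule Suc.IH)
      have "(d ^^ N) ((d ^^ n) (d a)) = (d ^^ n) ((d ^^ Suc N) a)"
        by (metis add.commute comp_apply funpow_Suc_right funpow_add)
      then show "(d ^^ N) ((d ^^ n) (d a)) = 0"
        using Suc.prems(1) by (simp add: linQ_0[OF linQ_funpow[OF linear]] del: funpow.simps)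
      show "(d ^^ n) (d a) \<in> K"
        by (induction n) (use Suc.prems(2) K(1) in auto)
    qed
    let ?f = "\<lambda>n. (- 1) ^ Suc n *\<^sub>Q sh (s (Suc n)) ((d ^^ Suc n) a)"
    have "dix a = a + (\<Sum>n\<le>N. ?f n)"
      by (subst dix_eq[OF Suc.prems(1)], subst sum.atMost_Suc_shift) (simp del: replicate_Suc)
    then have a: "a = dix a + (- 1) *\<^sub>Q (\<Sum>n\<le>N. ?f n)"
      by (simp add: scaleQ_minus_left)
    have "?f n \<in> S" for n
      using scale mult s pow by (simp add: funpow_swap1 del: replicate_Suc power_Suc)
    then have "dix a + (- 1) *\<^sub>Q (\<Sum>n\<le>N. ?f n) \<in> S"
      by (rule add[OF K(2)[OF Suc.prems(2)] scale[OF sum]])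
    then show ?case by (rule ssubst[OF a, of "\<lambda>z. z \<in> S"])
  qed
  then show ?thesis using nilpotent by blast
qed

end

section \<open>Shuffle regularization\<close>

lemma H1_eq: "(H1 :: 'g :: {finite, ab_group_add} H set) = {p. rdel X0 p = 0}"
proof (intro equalityI subsetI)
  fix p :: "'g H" assume "p \<in> H1"
  then show "p \<in> {p. rdel X0 p = 0}"
    by (auto simp: H1_def linQ_add[OF linQ_rdel] linQ_scale[OF linQ_rdel] linQ_sum[OF linQ_rdel] rdel_conc)
next
  fix p :: "'g H" assume "p \<in> {p. rdel X0 p = 0}"
  then have p: "rdel X0 p = 0" by simp
  have "p = Poly_Mapping.lookup p [] *\<^sub>Q word [] + (\<Sum>g\<in>UNIV. rdel (X g) p \<odot> word [X g])"
  proof (rule falg_eqI_right)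
    show "rdel x p = rdel x (Poly_Mapping.lookup p [] *\<^sub>Q word [] + (\<Sum>g\<in>UNIV. rdel (X g) p \<odot> word [X g]))"
      for x
      by (cases x) (simp_all add: p linQ_add[OF linQ_rdel] linQ_scale[OF linQ_rdel]
          linQ_sum[OF linQ_rdel] rdel_conc)
  qed (simp add: lookup_add lookup_scaleQ scaleQ_rat_def lookup_word linQ_sum[OF linQ_lookup]
      lookup_conc_Nil)
  then show "p \<in> H1"
    unfolding H1_def by (intro CollectI exI[of _ "\<lambda>g. rdel (X g) p"] exI[of _ "Poly_Mapping.lookup p []"]) simp
qed

lemma H0_eq: "(H0 :: 'g :: {finite, ab_group_add} H set) = {p. ldel (X 0) p = 0 \<and> rdel X0 p = 0}"
proof (intro equalityI subsetI)
  fix p :: "'g H" assume "p \<in> H0"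
  then obtain c h k where p: "p = c *\<^sub>Q word [] + (\<Sum>g\<in>UNIV. word [X0] \<odot> h g \<odot> word [X g])
      + (\<Sum>g\<in>UNIV - {0}. word [X g] \<odot> k g)" and k: "\<And>g. rdel X0 (k g) = 0"
    unfolding H0_def H1_eq by blast
  have k0: "word [X g] \<odot> k g \<in> {p. rdel X0 p = 0}" for g
  proof -
    have "rdel X0 (word [X g] \<odot> k g) = 0"
    proof (rule falg_eqI_left)
      show "ldel x (rdel X0 (word [X g] \<odot> k g)) = ldel x 0" for x
        by (simp add: ldel_rdel ldel_conc k linQ_0[OF linQ_rdel] linQ_0[OF linQ_ldel])
      show "Poly_Mapping.lookup (rdel X0 (word [X g] \<odot> k g)) [] = Poly_Mapping.lookup 0 []"
        by (simp add: lookup_rdel) (simp add: ldel_conc flip: lookup_ldel)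
    qed
    then show ?thesis by simp
  qed
  have h0: "ldel (X 0) (word [X0] \<odot> h g \<odot> word [X g]) = 0" for g
  proof (rule falg_eqI_right)
    show "rdel x (ldel (X 0) (word [X0] \<odot> h g \<odot> word [X g])) = rdel x 0" for x
      by (simp add: ldel_rdel[symmetric] rdel_conc ldel_conc linQ_0[OF linQ_rdel] linQ_0[OF linQ_ldel])
    show "Poly_Mapping.lookup (ldel (X 0) (word [X0] \<odot> h g \<odot> word [X g])) [] = Poly_Mapping.lookup 0 []"
      using lookup_rdel[of "X 0" "word [X0] \<odot> h g \<odot> word [X g]" "[]"]
      by (simp add: lookup_ldel rdel_conc lookup_conc_Nil split: if_splits)
  qed
  show "p \<in> {p. ldel (X 0) p = 0 \<and> rdel X0 p = 0}"
    using k0 by (simp add: p linQ_add[OF linQ_ldel] linQ_scale[OF linQ_ldel] linQ_sum[OF linQ_ldel]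
        linQ_add[OF linQ_rdel] linQ_scale[OF linQ_rdel] linQ_sum[OF linQ_rdel] ldel_conc rdel_conc h0)
next
  fix p :: "'g H" assume "p \<in> {p. ldel (X 0) p = 0 \<and> rdel X0 p = 0}"
  then have p: "ldel (X 0) p = 0" "rdel X0 p = 0" by simp_all
  have X0: "ldel X0 p = (\<Sum>g\<in>UNIV. rdel (X g) (ldel X0 p) \<odot> word [X g])"
  proof (rule falg_eqI_right)
    show "rdel x (ldel X0 p) = rdel x (\<Sum>g\<in>UNIV. rdel (X g) (ldel X0 p) \<odot> word [X g])" for x
      by (cases x) (simp_all add: p ldel_rdel[symmetric] linQ_0[OF linQ_ldel]
          linQ_sum[OF linQ_rdel] rdel_conc)
    have "Poly_Mapping.lookup (ldel X0 p) [] = Poly_Mapping.lookup (rdel X0 p) []"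
      by (simp add: lookup_ldel lookup_rdel)
    then show "Poly_Mapping.lookup (ldel X0 p) [] =
        Poly_Mapping.lookup (\<Sum>g\<in>UNIV. rdel (X g) (ldel X0 p) \<odot> word [X g]) []"
      by (simp add: p linQ_sum[OF linQ_lookup] lookup_conc_Nil)
  qed
  have assoc: "ldel x (word [X0] \<odot> a \<odot> word [X g]) = (if x = X0 then a \<odot> word [X g] else 0)"
    for x :: "'g xletter" and a g
  proof -
    have "word [X0] \<odot> a \<odot> word [X g] = word [X0] \<odot> (a \<odot> word [X g])"
      by (rule linQ_eqI[where f = "\<lambda>a. word [X0] \<odot> a \<odot> word [X g]" and g = "\<lambda>a. word [X0] \<odot> (a \<odot> word [X g])"])
        (auto intro: linQ_compose[OF linQ_conc_left linQ_conc_right]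
          linQ_compose[OF linQ_conc_right linQ_conc_left])
    then show ?thesis by (simp add: ldel_conc)
  qed
  have "p = Poly_Mapping.lookup p [] *\<^sub>Q word []
      + (\<Sum>g\<in>UNIV. word [X0] \<odot> rdel (X g) (ldel X0 p) \<odot> word [X g])
      + (\<Sum>g\<in>UNIV - {0}. word [X g] \<odot> ldel (X g) p)" (is "p = ?q")
  proof (rule falg_eqI_left)
    show "ldel x p = ldel x ?q" for x
    proof (cases x)
      case 1: X0
      show ?thesis unfolding 1
        by (subst X0) (simp add: linQ_add[OF linQ_ldel] linQ_scale[OF linQ_ldel]
            linQ_sum[OF linQ_ldel] assoc ldel_conc)
    next
      case (X g)
      have "ldel x ?q = (\<Sum>h\<in>UNIV - {0}. if g = h then ldel (X h) p else 0)"
        by (simp add: X linQ_add[OF linQ_ldel] linQ_scale[OF linQ_ldel]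
            linQ_sum[OF linQ_ldel] assoc ldel_conc cong: if_cong)
      also have "\<dots> = ldel x p" using p by (auto simp: X)
      finally show ?thesis ..
    qed
  qed (simp add: lookup_add lookup_scaleQ scaleQ_rat_def lookup_word linQ_sum[OF linQ_lookup]
      lookup_conc_Nil)
  moreover have "\<forall>g. ldel (X g) p \<in> H1"
    by (simp add: H1_eq p ldel_rdel[symmetric] linQ_0[OF linQ_ldel])
  ultimately show "p \<in> H0"
    unfolding H0_def
    by (intro CollectI exI[of _ "\<lambda>g. ldel (X g) p"] exI[of _ "\<lambda>g. rdel (X g) (ldel X0 p)"]
        exI[of _ "Poly_Mapping.lookup p []"] conjI)
qed

interpretation leading: sh_slice "ldel (X (0 :: 'g :: {finite, ab_group_add}))" "X 0"
  by unfold_locales (simp_all add: linQ_ldel ldel_sh ldel_nilpotent)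

interpretation trailing: sh_slice "rdel X0" "X0 :: 'g :: {finite, ab_group_add} xletter"
  by unfold_locales
    (simp_all add: linQ_rdel rdel_sh rdel_nilpotent flip: replicate_append_same)

text \<open>
  The regularization in closed form: the projection that kills \<open>X0\<close>, followed by the one that kills
  \<open>X 0\<close>.
\<close>

definition reg_dix :: "'g :: {finite, ab_group_add} H \<Rightarrow> 'g H" where
  "reg_dix p = leading.dix (trailing.dix p)"

lemma linQ_reg_dix: "linQ reg_dix"
  unfolding reg_dix_def by (intro linQ_compose[OF leading.linQ_dix trailing.linQ_dix])

lemma reg_dix_sh: "reg_dix (sh p q) = sh (reg_dix p) (reg_dix q)"
  by (simp add: reg_dix_def leading.dix_sh trailing.dix_sh)

lemma rdel_replicate [simp]: "rdel X0 (word (replicate n (X g))) = 0"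
  by (cases n) (simp_all flip: replicate_append_same)

lemma rdel_leading_dix: "rdel X0 (leading.dix p) = leading.dix (rdel X0 p)"
  by (rule leading.dix_commute) (simp_all add: linQ_rdel rdel_sh ldel_rdel)

lemma reg_dix_H0: "reg_dix p \<in> H0"
  by (simp add: H0_eq reg_dix_def leading.d_dix rdel_leading_dix trailing.d_dix
      linQ_0[OF leading.linQ_dix])

lemma reg_dix_ident: "p \<in> H0 \<Longrightarrow> reg_dix p = p"
  by (simp add: H0_eq reg_dix_def leading.dix_kernel trailing.dix_kernel)

lemma one_H0: "word [] \<in> H0"
  by (simp add: H0_eq)

lemma reg_dix_X0: "reg_dix (word [X0]) = 0"
  by (simp add: reg_dix_def trailing.dix_slice[simplified] linQ_0[OF leading.linQ_dix])

lemma reg_dix_X: "reg_dix (word [X 0]) = 0"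
  by (simp add: reg_dix_def leading.dix_slice[simplified] trailing.dix_kernel)

text \<open>Taylor expansion in \<open>T\<close> along the derivation that removes a leading \<open>X 0\<close>.\<close>

definition regT_dix :: "'g :: {finite, ab_group_add} H \<Rightarrow> 'g H poly" where
  "regT_dix p = Abs_poly (\<lambda>n. reg_dix (dpow (ldel (X 0)) n p))"

lemma coeff_regT_dix: "coeff (regT_dix p) n = reg_dix (dpow (ldel (X 0)) n p)"
proof -
  obtain N where "(ldel (X 0) ^^ N) p = 0" using ldel_nilpotent[of "X 0" p] by blast
  then have "reg_dix (dpow (ldel (X 0)) n p) = 0" if "n > N" for n
    using dpow_eventually_0[OF linQ_ldel, where n = n and N = N and p = p] that
    by (simp add: linQ_0[OF linQ_reg_dix])
  then show ?thesis unfolding regT_dix_def by (subst coeff_Abs_poly) auto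
qed

lemma coeff_sh_poly: "coeff (sh_poly P Q) n = (\<Sum>i\<le>n. sh (coeff P i) (coeff Q (n - i)))"
proof -
  define M where "M = degree P + degree Q + n"
  have z: "coeff P i = 0" "coeff Q i = 0" if "i > M" for i
    using that by (simp_all add: M_def coeff_eq_0)
  have "coeff (sh_poly P Q) n =
      (\<Sum>i\<le>degree P. \<Sum>j\<le>degree Q. if i + j = n then sh (coeff P i) (coeff Q j) else 0)"
    by (simp add: sh_poly_def coeff_sum)
  also have "\<dots> = (\<Sum>i\<le>degree P. \<Sum>j\<le>M. if i + j = n then sh (coeff P i) (coeff Q j) else 0)"
    by (intro sum.cong refl sum.mono_neutral_left) (auto simp: M_def coeff_eq_0)
  also have "\<dots> = (\<Sum>i\<le>M. \<Sum>j\<le>M. if i + j = n then sh (coeff P i) (coeff Q j) else 0)"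
    by (intro sum.mono_neutral_left) (auto simp: M_def coeff_eq_0 intro!: sum.neutral)
  also have "\<dots> = (\<Sum>i\<le>M. if i \<le> n then sh (coeff P i) (coeff Q (n - i)) else 0)"
  proof (intro sum.cong refl)
    fix i
    have "(\<Sum>j\<le>M. if i + j = n then sh (coeff P i) (coeff Q j) else 0) =
        (\<Sum>j\<le>M. if j = n - i then if i \<le> n then sh (coeff P i) (coeff Q (n - i)) else 0 else 0)"
      by (intro sum.cong refl) auto
    moreover have "n - i \<le> M" by (simp add: M_def)
    ultimately show "(\<Sum>j\<le>M. if i + j = n then sh (coeff P i) (coeff Q j) else 0) =
        (if i \<le> n then sh (coeff P i) (coeff Q (n - i)) else 0)"
      by simp
  qed
  also have "\<dots> = (\<Sum>i\<le>n. sh (coeff P i) (coeff Q (n - i)))"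
    by (intro sum.mono_neutral_cong_right) (auto simp: M_def)
  finally show ?thesis .
qed

lemma is_regT_regT_dix: "is_regT (regT_dix :: 'g :: {finite, ab_group_add} H \<Rightarrow> _)"
proof -
  have pow_zero: "dpow (ldel (X 0)) n p = 0" if "ldel (X 0) p = 0" "n > 0" for n and p :: "'g H"
    using dpow_eventually_0[OF linQ_ldel, of 1 "X 0" p n] that by simp
  have H0: "regT_dix p = [:p:]" if "p \<in> H0" for p :: "'g H"
  proof (rule poly_eqI)
    fix n show "coeff (regT_dix p) n = coeff [:p:] n"
      using that pow_zero[of p n]
      by (cases n) (simp_all add: coeff_regT_dix reg_dix_ident H0_eq linQ_0[OF linQ_reg_dix])
  qed
  have "linQ (regT_dix :: 'g H \<Rightarrow> _)"
    by (rule linQI; rule poly_eqI)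
      (simp_all add: coeff_regT_dix coeff_scaleQ linQ_add[OF linQ_dpow[OF linQ_ldel]]
        linQ_scale[OF linQ_dpow[OF linQ_ldel]] linQ_add[OF linQ_reg_dix] linQ_scale[OF linQ_reg_dix])
  moreover have "regT_dix (sh p q) = sh_poly (regT_dix p) (regT_dix q)" for p q :: "'g H"
    by (rule poly_eqI)
      (simp add: coeff_regT_dix coeff_sh_poly linQ_sum[OF linQ_reg_dix] reg_dix_sh
        dpow_leibniz[where m = sh, OF linQ_ldel linQ_sh_left linQ_sh_right ldel_sh])
  moreover have "regT_dix (word [X0 :: 'g xletter]) = 0"
  proof (rule poly_eqI)
    fix n show "coeff (regT_dix (word [X0 :: 'g xletter])) n = coeff 0 n"
      using pow_zero[of "word [X0 :: 'g xletter]" n]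
      by (cases n) (simp_all add: coeff_regT_dix reg_dix_X0 linQ_0[OF linQ_reg_dix])
  qed
  moreover have "regT_dix (word [X (0 :: 'g)]) = monom (word []) 1"
  proof (rule poly_eqI)
    fix n show "coeff (regT_dix (word [X (0 :: 'g)])) n = coeff (monom (word []) 1) n"
    proof (cases "n \<le> 1")
      case True
      then have "n = 0 \<or> n = 1" by auto
      then show ?thesis
        by (auto simp: coeff_regT_dix reg_dix_X dpow_def reg_dix_ident[OF one_H0])
    next
      case False
      then show ?thesis
        using dpow_eventually_0[OF linQ_ldel, of 2 "X 0" "word [X (0 :: 'g)]" n]
        by (simp add: coeff_regT_dix numeral_2_eq_2 linQ_0[OF linQ_ldel] linQ_0[OF linQ_reg_dix])
    qed
  qed
  ultimately show ?thesis
    by (auto simp: is_regT_def alg_hom_on_def H0 one_H0 coeff_regT_dix reg_dix_H0)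
qed

text \<open>
  Two solutions agree on a subalgebra containing \<open>H0\<close> and both slices, hence first on the kernel of
  \<open>rdel X0\<close> and then everywhere.
\<close>

lemma is_regT_unique:
  fixes R R' :: "'g :: {finite, ab_group_add} H \<Rightarrow> 'g H poly"
  assumes "is_regT R" and "is_regT R'"
  shows "R = R'"
proof -
  define S where "S = {p. R p = R' p}"
  have add: "p + q \<in> S" if "p \<in> S" "q \<in> S" for p q
    using assms that by (simp add: S_def is_regT_def alg_hom_on_def linearQ_on_def)
  have scale: "r *\<^sub>Q p \<in> S" if "p \<in> S" for r p
    using assms that by (simp add: S_def is_regT_def alg_hom_on_def linearQ_on_def)
  have mult: "sh p q \<in> S" if "p \<in> S" "q \<in> S" for p q
    using assms that by (simp add: S_def is_regT_def alg_hom_on_def)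
  have H0: "H0 \<subseteq> S" using assms by (auto simp: S_def is_regT_def)
  have letters: "word [X0] \<in> S" "word [X 0] \<in> S"
    using assms by (simp_all add: S_def is_regT_def)
  have "{p. rdel X0 p = 0} \<subseteq> S"
  proof (rule leading.generate)
    show "ldel (X 0) p \<in> {p. rdel X0 p = 0}" if "p \<in> {p. rdel X0 p = 0}" for p :: "'g H"
      using that by (simp add: ldel_rdel[symmetric] linQ_0[OF linQ_ldel])
    show "leading.dix p \<in> S" if "p \<in> {p. rdel X0 p = 0}" for p
      using that H0 by (auto simp: H0_eq leading.d_dix rdel_leading_dix linQ_0[OF leading.linQ_dix])
  qed (use add scale mult H0 one_H0 letters in auto)
  then have "UNIV \<subseteq> S"
    by (intro trailing.generate add scale mult) (use H0 one_H0 letters trailing.d_dix in auto)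
  then show ?thesis by (auto simp: S_def)
qed

lemma regT_eq: "regT = regT_dix"
  unfolding regT_def by (rule the_equality, rule is_regT_regT_dix, erule is_regT_unique[OF _ is_regT_regT_dix])

lemma coeff_regT: "coeff (regT p) n = reg_dix (dpow (ldel (X 0)) n p)"
  by (simp add: regT_eq coeff_regT_dix)

lemma reg_eq: "reg p = reg_dix p"
  by (simp add: reg_def coeff_regT)

section \<open>The harmonic product\<close>

lemma linQ_harm_left: "linQ (\<lambda>p. harm p q)" and linQ_harm_right: "linQ (harm p)"
  by (simp_all add: harm_def bilin_ext_linear_left bilin_ext_linear_right)

lemma harm_word_eq [simp]: "harm (word u) (word v) = harm_word u v"
  by (simp add: harm_def)

lemma harm_word_Nil_right [simp]: "harm_word w [] = word w"
  by (cases w) simp_all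

text \<open>
  The third summand in the recursion of the harmonic product begins with a letter \<open>Y (m + n + 1) g\<close>,
  which is never \<open>Y 0 0\<close>.
\<close>

lemma ldel_harm: "ldel (Y 0 0) (harm p q) = harm (ldel (Y 0 0) p) q + harm p (ldel (Y 0 0) q)"
proof (rule bilin_eqI[where f = "\<lambda>p q. ldel (Y 0 0) (harm p q)"
      and g = "\<lambda>p q. harm (ldel (Y 0 0) p) q + harm p (ldel (Y 0 0) q)"])
  have [simp]: "harm 0 q = 0" "harm p 0 = 0" for p q :: "'a yletter falg"
    using linQ_0[OF linQ_harm_left] linQ_0[OF linQ_harm_right] by auto
  show "ldel (Y 0 0) (harm (word u) (word v)) =
      harm (ldel (Y 0 0) (word u)) (word v) + harm (word u) (ldel (Y 0 0) (word v))" for u v :: "'a yletter list"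
  proof (cases "u = [] \<or> v = []")
    case True
    then show ?thesis by (elim disjE; cases u; cases v) auto
  next
    case False
    then obtain m g u' n h v' where "u = Y m g # u'" "v = Y n h # v'"
      by (metis list.exhaust yletter.exhaust)
    then show ?thesis by (simp add: linQ_add[OF linQ_ldel] ldel_conc)
  qed
qed (rule linQI; simp add: linQ_add[OF linQ_harm_left] linQ_add[OF linQ_harm_right]
    linQ_scale[OF linQ_harm_left] linQ_scale[OF linQ_harm_right] scaleQ_add_right
    linQ_add[OF linQ_ldel] linQ_scale[OF linQ_ldel])+

section \<open>Coproducts dual to the products\<close>

lemma sum_take_eq:
  "(\<Sum>i\<le>length u. if take i u = a then f i else 0) =
    (if take (length a) u = a then f (length a) else (0 :: 'b :: comm_monoid_add))"
proof -
  have len: "i = length a" if "take i u = a" "i \<le> length u" for i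
  proof -
    have "length (take i u) = length a" by (rule arg_cong[OF that(1)])
    then show ?thesis unfolding length_take min_absorb2[OF that(2)] .
  qed
  show ?thesis
  proof (cases "take (length a) u = a")
    case True
    have "length (take (length a) u) = length a" by (rule arg_cong[OF True])
    then have le: "length a \<le> length u" unfolding length_take by linarith
    have "(\<Sum>i\<le>length u. if take i u = a then f i else 0) = (\<Sum>i\<in>{length a}. f i)"
    proof (rule sum.mono_neutral_cong_right)
      show "{length a} \<subseteq> {..length u}" using le by blast
      show "\<forall>i\<in>{..length u} - {length a}. (if take i u = a then f i else 0) = 0"
      proof
        fix i assume "i \<in> {..length u} - {length a}"
        then have i: "i \<noteq> length a" "i \<le> length u" by simp_all
        have "take i u \<noteq> a" by (rule notI) (rule notE[OF i(1) len[OF _ i(2)]])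
        then show "(if take i u = a then f i else 0) = 0" by (rule if_not_P)
      qed
      fix i assume "i \<in> {length a}"
      then have "i = length a" by (rule singletonD)
      then show "(if take i u = a then f i else 0) = f i" by (simp only: if_P[OF True])
    qed (rule finite_atMost)
    also have "\<dots> = f (length a)" by simp
    finally show ?thesis unfolding if_P[OF True] .
  next
    case False
    have "take i u \<noteq> a" if "i \<le> length u" for i
    proof
      assume i: "take i u = a"
      show False by (rule notE[OF False]) (unfold len[OF i that, symmetric], rule i)
    qed
    then show ?thesis using False by (simp add: sum.neutral)
  qed
qed

lemma ser2_mult_tens:
  "ser2_mult (tens (ser_word a) (ser_word b)) G (u, v) =
    (if take (length a) u = a \<and> take (length b) v = b
     then G (drop (length a) u, drop (length b) v) else 0)"
proof -
  have "ser2_mult (tens (ser_word a) (ser_word b)) G (u, v) =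
      (\<Sum>i\<le>length u. if take i u = a
        then \<Sum>j\<le>length v. if take j v = b then G (drop i u, drop j v) else 0 else 0)"
    by (auto simp: ser2_mult_def tens_def ser_word_def intro!: sum.cong)
  then show ?thesis by (simp add: sum_take_eq)
qed

lemma ser2_mult_add:
  "ser2_mult (\<lambda>p. F p + G p) H w = ser2_mult F H w + ser2_mult G H w"
  by (cases w) (simp add: ser2_mult_def distrib_right sum.distrib)

lemma ser2_mult_sum:
  "ser2_mult (\<lambda>p. \<Sum>k\<in>A. F k p) H w = (\<Sum>k\<in>A. ser2_mult (F k) H w)"
proof -
  have "ser2_mult (\<lambda>p. 0) H w = 0" by (cases w) (simp add: ser2_mult_def)
  then show ?thesis by (induction A rule: infinite_finite_induct) (simp_all add: ser2_mult_add)
qed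

text \<open>
  The coefficient of \<open>u \<otimes> v\<close> in the coproduct of a word \<open>w\<close> is the coefficient of \<open>w\<close> in the product
  of \<open>u\<close> and \<open>v\<close>.
\<close>

lemma word_hom_sh:
  "word_hom delta_sh_letter w (u, v) = Poly_Mapping.lookup (sh_word u v) w *\<^sub>Q (1 :: 'a :: comm_rat_algebra)"
proof (induction w arbitrary: u v)
  case Nil
  have "Poly_Mapping.lookup (sh_word u v) [] = (if u = [] \<and> v = [] then 1 else 0)"
    using lookup_sh_Nil[of "word u" "word v"] by (simp add: lookup_word)
  then show ?case by (simp add: tens_def ser_word_def)
next
  case (Cons x w)
  have "Poly_Mapping.lookup (sh_word u v) (x # w) =
      Poly_Mapping.lookup (sh (ldel x (word u)) (word v)) w
      + Poly_Mapping.lookup (sh (word u) (ldel x (word v))) w"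
    using ldel_sh[of x "word u" "word v"] by (simp add: lookup_add flip: lookup_ldel)
  then show ?case
    by (cases u; cases v)
      (auto simp: delta_sh_letter_def[of x] ser2_mult_add ser2_mult_tens Cons scaleQ_add_left)
qed

lemma word_hom_harm:
  "word_hom delta_harm_letter w (u, v) = Poly_Mapping.lookup (harm_word u v) w *\<^sub>Q (1 :: 'a :: comm_rat_algebra)"
proof (induction w arbitrary: u v)
  case Nil
  show ?case
    by (cases "(u, v)" rule: harm_word.cases)
      (auto simp: tens_def ser_word_def lookup_word lookup_add lookup_conc_Nil)
next
  case (Cons x w)
  obtain m g where x: "x = Y m g" by (cases x)
  let ?W = "word_hom delta_harm_letter w :: _ \<Rightarrow> 'a"
  have "word_hom delta_harm_letter (x # w) (u, v) =
      (if take 1 u = [x] then ?W (drop 1 u, v) else 0) + (if take 1 v = [x] then ?W (u, drop 1 v) else 0)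
      + (\<Sum>j<m. \<Sum>h\<in>UNIV. if take 1 u = [Y j h] \<and> take 1 v = [Y (m - 1 - j) (g - h)]
          then ?W (drop 1 u, drop 1 v) else 0)" (is "_ = ?a + ?b + ?c")
    by (simp add: x ser2_mult_add ser2_mult_sum ser2_mult_tens cong: if_cong)
  moreover have "Poly_Mapping.lookup (harm_word u v) (x # w) *\<^sub>Q (1 :: 'a) = ?a + ?b + ?c"
  proof (cases "u = [] \<or> v = []")
    case True
    then show ?thesis
      by (elim disjE; cases u; cases v) (auto simp: Cons ldel_conc simp flip: lookup_ldel)
  next
    case False
    then obtain m1 g1 u' m2 g2 v' where uv: "u = Y m1 g1 # u'" "v = Y m2 g2 # v'"
      by (metis list.exhaust yletter.exhaust)
    have "?c = (\<Sum>j<m. \<Sum>h\<in>UNIV. if h = g1 then if j = m1 then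
        if m2 = m - 1 - m1 \<and> g2 = g - g1 then ?W (u', v') else 0 else 0 else 0)"
      by (intro sum.cong refl) (auto simp: uv)
    also have "\<dots> = (if m = m1 + m2 + 1 \<and> g = g1 + g2 then ?W (u', v') else 0)"
      by (auto simp: algebra_simps)
    finally have c: "?c = (if x = Y (m1 + m2 + 1) (g1 + g2) then ?W (u', v') else 0)"
      by (simp only: x yletter.inject)
    have a: "?a = (if x = Y m1 g1 then ?W (u', v) else 0)" "?b = (if x = Y m2 g2 then ?W (u, v') else 0)"
      by (auto simp: uv)
    have if_scale: "(if b then r else 0) *\<^sub>Q (1 :: 'a) = (if b then r *\<^sub>Q 1 else 0)" for b r
      by simp
    have lookup_if: "Poly_Mapping.lookup (if b then p else 0) w = (if b then Poly_Mapping.lookup p w else 0)"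
      for b and p :: "'b yletter falg"
      by simp
    have "Poly_Mapping.lookup (harm_word u v) (x # w) =
        (if x = Y m1 g1 then Poly_Mapping.lookup (harm_word u' v) w else 0)
        + (if x = Y m2 g2 then Poly_Mapping.lookup (harm_word u v') w else 0)
        + (if x = Y (m1 + m2 + 1) (g1 + g2) then Poly_Mapping.lookup (harm_word u' v') w else 0)"
      by (simp only: uv harm_word.simps linQ_add[OF linQ_ldel] ldel_conc lookup_add lookup_if
          flip: lookup_ldel)
    then show ?thesis
      unfolding a c by (simp only: Cons scaleQ_add_left if_scale)
  qed
  ultimately show ?case by simp
qed

lemma cont_ext_eq:
  fixes F :: "('x, 'a :: comm_rat_algebra) series"
  assumes "\<And>w. L w v = Poly_Mapping.lookup p w *\<^sub>Q 1"
  shows "cont_ext L F v = lin_ext F p"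
proof -
  have "cont_ext L F v = (\<Sum>w\<in>Poly_Mapping.keys p. F w * L w v)"
    unfolding cont_ext_def by (rule sum.mono_neutral_left) (auto simp: assms in_keys_iff)
  then show ?thesis by (simp add: lin_ext_def assms scaleQ_mult_right)
qed

lemma delta_sh_eq: "delta_sh F (u, v) = lin_ext F (sh_word u v)"
  unfolding delta_sh_def by (rule cont_ext_eq) (rule word_hom_sh)

lemma delta_harm_eq: "delta_harm F (u, v) = lin_ext F (harm_word u v)"
  unfolding delta_harm_def by (rule cont_ext_eq) (rule word_hom_harm)

lemma grouplike_iff:
  fixes F :: "('x, 'a :: comm_rat_algebra) series"
  assumes l: "\<And>q. linQ (\<lambda>p. m p q)" and r: "\<And>p. linQ (m p)"
    and \<Delta>: "\<And>u v. \<Delta> (u, v) = lin_ext F (m (word u) (word v))"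
  shows "\<Delta> = tens F F \<longleftrightarrow> (\<forall>p q. lin_ext F (m p q) = lin_ext F p * lin_ext F q)"
proof
  assume "\<Delta> = tens F F"
  then have *: "lin_ext F (m (word u) (word v)) = F u * F v" for u v
    using \<Delta>[of u v] by (simp add: tens_def)
  show "\<forall>p q. lin_ext F (m p q) = lin_ext F p * lin_ext F q"
  proof (intro allI)
    fix p q show "lin_ext F (m p q) = lin_ext F p * lin_ext F q"
      by (rule bilin_eqI[where f = "\<lambda>p q. lin_ext F (m p q)" and g = "\<lambda>p q. lin_ext F p * lin_ext F q"])
        (rule linQI; simp add: * linQ_add[OF l] linQ_add[OF r] linQ_scale[OF l] linQ_scale[OF r]
          linQ_add[OF linQ_lin_ext] linQ_scale[OF linQ_lin_ext] distrib_left distrib_right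
          scaleQ_mult_left scaleQ_mult_right | simp add: *)+
  qed
next
  assume "\<forall>p q. lin_ext F (m p q) = lin_ext F p * lin_ext F q"
  then have "\<Delta> (u, v) = F u * F v" for u v by (simp add: \<Delta>)
  then show "\<Delta> = tens F F" by (auto simp: tens_def fun_eq_iff)
qed

lemma delta_sh_grouplike_iff:
  "delta_sh F = tens F F \<longleftrightarrow> (\<forall>p q. lin_ext F (sh p q) = lin_ext F p * lin_ext F q)"
  by (rule grouplike_iff) (simp_all add: linQ_sh_left linQ_sh_right delta_sh_eq)

lemma delta_harm_grouplike_iff:
  "delta_harm F = tens F F \<longleftrightarrow> (\<forall>p q. lin_ext F (harm p q) = lin_ext F p * lin_ext F q)"
  by (rule grouplike_iff) (simp_all add: linQ_harm_left linQ_harm_right delta_harm_eq)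

section \<open>The substitution of group elements\<close>

text \<open>
  The inverse of \<open>q_word_from h\<close>, taking partial sums of the group elements; \<open>h\<close> is the sum of
  those read so far.
\<close>

fun q_inv_from :: "'g :: ab_group_add \<Rightarrow> 'g xletter list \<Rightarrow> 'g xletter list" where
  "q_inv_from h [] = []"
| "q_inv_from h (X0 # w) = X0 # q_inv_from h w"
| "q_inv_from h (X g # w) = X (g + h) # q_inv_from (g + h) w"

lemma q_word_inv: "q_word_from h (q_inv_from h w) = w"
  by (induction h w rule: q_inv_from.induct) simp_all

lemma q_inv_word: "q_inv_from h (q_word_from h w) = w"
  by (induction h w rule: q_word_from.induct) simp_all

lemma q_word_eq_iff: "v = q_word w \<longleftrightarrow> w = q_inv_from 0 v"
  unfolding q_word_def using q_word_inv q_inv_word by metis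

lemma q_ser_eq: "q_ser F v = F (q_inv_from 0 v)"
proof -
  have "q_ser F v = lin_ext F (word (q_inv_from 0 v))"
    unfolding q_ser_def by (rule cont_ext_eq) (auto simp: ser_word_def lookup_word q_word_eq_iff)
  then show ?thesis by simp
qed

lemma inv_qG: "inv qG = lin_ext (\<lambda>w. word (q_inv_from 0 w))"
proof (rule inv_unique_comp)
  show "qG \<circ> lin_ext (\<lambda>w. word (q_inv_from 0 w)) = id"
  proof (rule ext)
    fix p show "(qG \<circ> lin_ext (\<lambda>w. word (q_inv_from 0 w))) p = id p"
      unfolding comp_def id_def qG_def
      by (rule linQ_eqI[OF linQ_compose[OF linQ_lin_ext linQ_lin_ext] linQ_ident])
        (simp add: q_word_def q_word_inv)
  qed
  show "lin_ext (\<lambda>w. word (q_inv_from 0 w)) \<circ> qG = id"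
  proof (rule ext)
    fix p show "(lin_ext (\<lambda>w. word (q_inv_from 0 w)) \<circ> qG) p = id p"
      unfolding comp_def id_def qG_def
      by (rule linQ_eqI[OF linQ_compose[OF linQ_lin_ext linQ_lin_ext] linQ_ident])
        (simp add: q_word_def q_inv_word)
  qed
qed

text \<open>The embedding of the free algebra on the \<open>Y m g\<close>, followed by the inverse of \<open>qG\<close>.\<close>

definition y_to_H :: "'g :: {finite, ab_group_add} yletter falg \<Rightarrow> 'g H" where
  "y_to_H a = inv qG (y_embed a)"

lemma linQ_y_to_H: "linQ y_to_H"
  unfolding y_to_H_def inv_qG y_embed_def by (intro linQ_compose[OF linQ_lin_ext linQ_lin_ext])

lemma y_to_H_word: "y_to_H (word w) = word (q_inv_from 0 (y_word w))"
  by (simp add: y_to_H_def inv_qG y_embed_def)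

text \<open>
  A leading \<open>X 0\<close> leaves the partial sums unchanged, so removing it commutes with the inverse of \<open>qG\<close>.
\<close>

lemma ldel_y_to_H: "ldel (X 0) (y_to_H a) = y_to_H (ldel (Y 0 0) a)"
proof (rule linQ_eqI[OF linQ_compose[OF linQ_ldel linQ_y_to_H] linQ_compose[OF linQ_y_to_H linQ_ldel]])
  fix w :: "'a yletter list"
  show "ldel (X 0) (y_to_H (word w)) = y_to_H (ldel (Y 0 0) (word w))"
  proof (cases w)
    case Nil
    then show ?thesis by (simp add: y_to_H_word y_word_def linQ_0[OF linQ_y_to_H])
  next
    case (Cons y v)
    obtain m g where y: "y = Y m g" by (cases y)
    show ?thesis
      by (cases m) (auto simp: Cons y y_to_H_word y_word_def linQ_0[OF linQ_y_to_H])
  qed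
qed

lemma dpow_y_to_H: "dpow (ldel (X 0)) n (y_to_H a) = y_to_H (dpow (ldel (Y 0 0)) n a)"
proof -
  have "(ldel (X 0) ^^ n) (y_to_H a) = y_to_H ((ldel (Y 0 0) ^^ n) a)"
    by (induction n) (simp_all add: ldel_y_to_H)
  then show ?thesis by (simp add: dpow_def linQ_scale[OF linQ_y_to_H])
qed

section \<open>Exponentials\<close>

text \<open>
  The powers of a series as they occur in \<open>fps_expQ\<close>. The coefficients need not form a ring with
  \<open>0 \<noteq> 1\<close>, so series over them carry no power operation.
\<close>

definition fps_pow :: "'a :: comm_rat_algebra fps \<Rightarrow> nat \<Rightarrow> 'a fps" where
  "fps_pow s n = ((*) s ^^ n) 1"

lemma fps_pow_0: "fps_pow s 0 = 1"
  by (simp add: fps_pow_def)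

lemma fps_pow_Suc: "fps_pow s (Suc n) = s * fps_pow s n"
  by (simp add: fps_pow_def)

lemma fps_one_mult: "1 * f = (f :: 'a :: comm_rat_algebra fps)"
proof (rule fps_ext)
  fix n
  have "fps_nth (1 * f) n = (\<Sum>i=0..n. if i = 0 then fps_nth f n else 0)"
    unfolding fps_mult_nth by (intro sum.cong refl) simp
  then show "fps_nth (1 * f) n = fps_nth f n" by simp
qed

lemma fps_pow_add: "fps_pow s m * fps_pow s n = fps_pow s (m + n)"
  by (induction m) (simp_all add: fps_pow_0 fps_pow_Suc fps_one_mult mult.assoc)

lemma fps_pow_nth_0:
  assumes s: "fps_nth s 0 = 0"
  shows "k < n \<Longrightarrow> fps_nth (fps_pow s n) k = 0"
proof (induction n arbitrary: k)
  case (Suc n)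
  have "fps_nth s i * fps_nth (fps_pow s n) (k - i) = 0" if "i \<le> k" for i
    using s Suc that by (cases i) simp_all
  then show ?case by (simp add: fps_pow_Suc fps_mult_nth)
qed simp

lemma fps_pow_uminus: "fps_nth (fps_pow (- s) n) k = (- 1) ^ n *\<^sub>Q fps_nth (fps_pow s n) k"
proof (induction n arbitrary: k)
  case 0
  show ?case by (simp add: fps_pow_0)
next
  case (Suc n)
  show ?case
    by (simp add: fps_pow_Suc fps_mult_nth Suc scaleQ_mult_right scaleQ_sum_right sum_negf
        scaleQ_minus_left)
qed

lemma fps_expQ_nth:
  assumes "fps_nth s 0 = 0" and "k \<le> N"
  shows "fps_nth (fps_expQ s) k = (\<Sum>n\<le>N. (1 / fact n) *\<^sub>Q fps_nth (fps_pow s n) k)"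
  unfolding fps_expQ_def fps_pow_def[symmetric] Abs_fps_inverse fps_nth_Abs_fps
  using assms by (intro sum.mono_neutral_left) (auto simp: fps_pow_nth_0)

lemma alternating_fact_sum:
  "(\<Sum>i\<le>n. (1 / fact i) * ((- 1) ^ (n - i) / fact (n - i)) :: rat) = (if n = 0 then 1 else 0)"
proof -
  have "(\<Sum>i\<le>n. (1 / fact i) * ((- 1) ^ (n - i) / fact (n - i)) :: rat) =
      (\<Sum>i\<le>n. (1 / fact n) * (of_nat (n choose i) * 1 ^ i * (- 1) ^ (n - i)))"
    by (intro sum.cong refl) (simp add: binomial_fact)
  also have "\<dots> = (1 / fact n) * (1 + (- 1)) ^ n"
    unfolding binomial_ring sum_distrib_left ..
  finally show ?thesis by (simp add: power_0_left)
qed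

lemma fps_expQ_uminus:
  fixes s :: "'a :: comm_rat_algebra fps"
  assumes s: "fps_nth s 0 = 0"
  shows "fps_expQ s * fps_expQ (- s) = 1"
proof (rule fps_ext)
  fix N
  define t where "t n m = ((1 / fact n) * ((- 1) ^ m / fact m)) *\<^sub>Q fps_nth (fps_pow s (n + m)) N"
    for n m :: nat
  have t_0: "t n m = 0" if "n + m > N" for n m
    using that by (simp add: t_def fps_pow_nth_0[OF s])
  have "fps_nth (fps_expQ s * fps_expQ (- s)) N =
      (\<Sum>i=0..N. (\<Sum>n\<le>N. (1 / fact n) *\<^sub>Q fps_nth (fps_pow s n) i) *
        (\<Sum>m\<le>N. ((- 1) ^ m / fact m) *\<^sub>Q fps_nth (fps_pow s m) (N - i)))"
    unfolding fps_mult_nth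
    by (intro sum.cong refl) (simp add: fps_expQ_nth[where N = N] s fps_pow_uminus)
  also have "\<dots> = (\<Sum>i=0..N. \<Sum>n\<le>N. \<Sum>m\<le>N. ((1 / fact n) * ((- 1) ^ m / fact m)) *\<^sub>Q
      (fps_nth (fps_pow s n) i * fps_nth (fps_pow s m) (N - i)))"
    by (simp add: sum_product scaleQ_mult_left scaleQ_mult_right mult.commute)
  also have "\<dots> = (\<Sum>n\<le>N. \<Sum>m\<le>N. \<Sum>i=0..N. ((1 / fact n) * ((- 1) ^ m / fact m)) *\<^sub>Q
      (fps_nth (fps_pow s n) i * fps_nth (fps_pow s m) (N - i)))"
    by (rule trans[OF sum.swap sum.cong[OF refl sum.swap]])
  also have "\<dots> = (\<Sum>n\<le>N. \<Sum>m\<le>N. t n m)"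
    by (intro sum.cong refl)
      (simp only: t_def fps_pow_add[symmetric] fps_mult_nth scaleQ_sum_right)
  also have "\<dots> = (\<Sum>k\<le>N. \<Sum>n\<le>k. t n (k - n))"
    by (rule sum_square_triangle) (rule t_0)
  also have "\<dots> = (\<Sum>k\<le>N. (if k = 0 then 1 else 0) *\<^sub>Q fps_nth (fps_pow s k) N)"
    unfolding t_def alternating_fact_sum[symmetric] scaleQ_sum_left
    by (intro sum.cong refl) simp
  also have "\<dots> = (\<Sum>k\<le>N. if k = 0 then fps_nth 1 N else 0)"
    by (intro sum.cong refl) (simp add: fps_pow_0)
  finally show "fps_nth (fps_expQ s * fps_expQ (- s)) N = fps_nth 1 N"
    by simp
qed

text \<open>
  Non-commutative series in the powers of a single letter \<open>y\<close> are multiplied like ordinary power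
  series.
\<close>

lemma ser_exp_powers_of_letter:
  fixes t :: "'a :: comm_rat_algebra fps"
  shows "ser_exp (\<lambda>w. if w = replicate (length w) y then fps_nth t (length w) else 0) w =
    (if w = replicate (length w) y then fps_nth (fps_expQ t) (length w) else 0)"
proof -
  define S where "S = (\<lambda>w. if w = replicate (length w) y then fps_nth t (length w) else 0)"
  have pow: "((ser_mult S ^^ n) (ser_word [])) v =
      (if v = replicate (length v) y then fps_nth (fps_pow t n) (length v) else 0)" for n v
  proof (induction n arbitrary: v)
    case 0
    show ?case by (auto simp: ser_word_def fps_pow_0)
  next
    case (Suc n)
    have split: "S (take i v) * ((ser_mult S ^^ n) (ser_word [])) (drop i v) =
        (if v = replicate (length v) y then fps_nth t i * fps_nth (fps_pow t n) (length v - i) else 0)"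
      if i: "i \<le> length v" for i
    proof (cases "v = replicate (length v) y")
      case True
      then obtain k where v: "v = replicate k y" by blast
      show ?thesis using i by (simp only: v Suc) (simp add: S_def min_def)
    next
      case False
      have "\<not> (take i v = replicate i y \<and> drop i v = replicate (length v - i) y)"
      proof
        assume "take i v = replicate i y \<and> drop i v = replicate (length v - i) y"
        then have "v = replicate i y @ replicate (length v - i) y"
          by (metis append_take_drop_id)
        then show False using False i by (simp flip: replicate_add)
      qed
      then show ?thesis using i False unfolding Suc by (auto simp: S_def min_def)
    qed
    have "((ser_mult S ^^ Suc n) (ser_word [])) v =
        (\<Sum>i\<le>length v. S (take i v) * ((ser_mult S ^^ n) (ser_word [])) (drop i v))"
      by (simp add: ser_mult_def)
    also have "\<dots> = (\<Sum>i\<le>length v. if v = replicate (length v) y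
        then fps_nth t i * fps_nth (fps_pow t n) (length v - i) else 0)"
      by (intro sum.cong refl split) simp
    finally show ?case by (simp add: fps_pow_Suc fps_mult_nth atLeast0AtMost)
  qed
  show ?thesis
    unfolding S_def[symmetric]
    by (simp add: ser_exp_def pow fps_expQ_def flip: fps_pow_def)
qed

section \<open>Power series in the derivative\<close>

text \<open>The operator \<open>\<Sum>\<^sub>k c k (d/dT)\<^sup>k\<close> on polynomials in \<open>T\<close>.\<close>

definition shift_op :: "(nat \<Rightarrow> 'a) \<Rightarrow> 'a :: comm_rat_algebra poly \<Rightarrow> 'a poly" where
  "shift_op c p = Abs_poly (\<lambda>j. (1 / fact j) *\<^sub>Q
    (\<Sum>k\<le>degree p. c k * (fact (j + k) *\<^sub>Q coeff p (j + k))))"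

lemma coeff_shift_op:
  assumes "degree p \<le> N"
  shows "coeff (shift_op c p) j = (1 / fact j) *\<^sub>Q (\<Sum>k\<le>N. c k * (fact (j + k) *\<^sub>Q coeff p (j + k)))"
proof -
  have "coeff (shift_op c p) j = (1 / fact j) *\<^sub>Q
      (\<Sum>k\<le>degree p. c k * (fact (j + k) *\<^sub>Q coeff p (j + k)))"
    unfolding shift_op_def by (subst coeff_Abs_poly[of "degree p"]) (simp_all add: coeff_eq_0)
  also have "(\<Sum>k\<le>degree p. c k * (fact (j + k) *\<^sub>Q coeff p (j + k))) =
      (\<Sum>k\<le>N. c k * (fact (j + k) *\<^sub>Q coeff p (j + k)))"
    using assms by (intro sum.mono_neutral_left) (auto simp: coeff_eq_0)
  finally show ?thesis .
qed

lemma degree_shift_op: "degree (shift_op c p) \<le> degree p"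
  by (rule degree_le) (simp add: coeff_shift_op[OF order_refl] coeff_eq_0)

lemma shift_op_inverse:
  fixes b c :: "nat \<Rightarrow> 'a :: comm_rat_algebra"
  assumes inv: "\<And>n. (\<Sum>k\<le>n. b k * c (n - k)) = (if n = 0 then 1 else 0)"
  shows "shift_op b (shift_op c p) = p"
proof (rule poly_eqI)
  fix j
  define N where "N = degree p"
  define r where "r m = fact m *\<^sub>Q coeff p m" for m
  have r_0: "r m = 0" if "m > N" for m using that by (simp add: r_def N_def coeff_eq_0)
  have "coeff (shift_op b (shift_op c p)) j =
      (1 / fact j) *\<^sub>Q (\<Sum>k\<le>N. b k * (\<Sum>l\<le>N. c l * r (j + k + l)))"
    by (simp add: coeff_shift_op[OF degree_shift_op] coeff_shift_op[of p N] N_def r_def)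
  also have "(\<Sum>k\<le>N. b k * (\<Sum>l\<le>N. c l * r (j + k + l))) =
      (\<Sum>k\<le>N. \<Sum>l\<le>N. b k * c l * r (j + (k + l)))"
    by (simp add: sum_distrib_left mult.assoc add.assoc)
  also have "\<dots> = (\<Sum>n\<le>N. \<Sum>k\<le>n. b k * c (n - k) * r (j + (k + (n - k))))"
    by (rule sum_square_triangle) (simp add: r_0)
  also have "\<dots> = (\<Sum>n\<le>N. (\<Sum>k\<le>n. b k * c (n - k)) * r (j + n))"
    by (simp add: sum_distrib_right)
  also have "\<dots> = (\<Sum>n\<le>N. if n = 0 then r j else 0)"
    unfolding inv by (intro sum.cong refl) simp
  finally show "coeff (shift_op b (shift_op c p)) j = coeff p j"
    by (simp add: r_def)
qed

lemma is_rho_shift_op: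
  fixes Z :: "'g :: {finite, ab_group_add} H \<Rightarrow> 'a :: comm_rat_algebra"
  shows "is_rho Z (shift_op (fps_nth (rho_series Z)))"
proof -
  let ?c = "fps_nth (rho_series Z)"
  have "shift_op ?c (p + q) = shift_op ?c p + shift_op ?c q" for p q
  proof (rule poly_eqI)
    fix j
    let ?N = "max (degree p) (degree q)"
    show "coeff (shift_op ?c (p + q)) j = coeff (shift_op ?c p + shift_op ?c q) j"
      by (simp add: coeff_shift_op[of _ ?N] degree_add_le scaleQ_add_right distrib_left sum.distrib)
  qed
  moreover have "shift_op ?c (smult a p) = smult a (shift_op ?c p)" for a p
  proof (rule poly_eqI)
    fix j
    show "coeff (shift_op ?c (smult a p)) j = coeff (smult a (shift_op ?c p)) j"
      by (simp add: coeff_shift_op[of _ "degree p"] degree_smult_le scaleQ_mult_right sum_distrib_left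
          mult.left_commute)
  qed
  moreover have "Abs_fps (\<lambda>m. shift_op ?c (fps_nth exp_Tu m)) = Abs_fps (\<lambda>k. [:?c k:]) * exp_Tu"
  proof (rule fps_ext, rule poly_eqI)
    fix m j
    have deg: "degree (monom ((1 / fact m) *\<^sub>Q (1 :: 'a)) m) \<le> m" by (rule degree_monom_le)
    have "coeff (shift_op ?c (fps_nth exp_Tu m)) j = (1 / fact j) *\<^sub>Q
        (\<Sum>k\<le>m. if j + k = m then ?c k else 0)"
      unfolding exp_Tu_def fps_nth_Abs_fps coeff_shift_op[OF deg]
      by (intro arg_cong[where f = "(*\<^sub>Q) _"] sum.cong refl) (simp add: scaleQ_mult_right)
    also have "(\<Sum>k\<le>m. if j + k = m then ?c k else 0) = (\<Sum>k\<le>m. if m - k = j then ?c k else 0)"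
      by (intro sum.cong refl) auto
    also have "(1 / fact j) *\<^sub>Q \<dots> = (\<Sum>k\<le>m. if m - k = j then (1 / fact j) *\<^sub>Q ?c k else 0)"
      unfolding scaleQ_sum_right by (intro sum.cong refl) simp
    also have "\<dots> = coeff (fps_nth (Abs_fps (\<lambda>k. [:?c k:]) * exp_Tu) m) j"
      unfolding fps_mult_nth coeff_sum atLeast0AtMost
      by (intro sum.cong refl) (auto simp: exp_Tu_def scaleQ_mult_right)
    finally show "coeff (fps_nth (Abs_fps (\<lambda>m. shift_op ?c (fps_nth exp_Tu m))) m) j =
        coeff (fps_nth (Abs_fps (\<lambda>k. [:?c k:]) * exp_Tu) m) j"
      by simp
  qed
  ultimately show ?thesis by (simp add: is_rho_def)
qed

lemma is_rho_unique:
  assumes "is_rho Z r" and "is_rho Z r'"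
  shows "r = r'"
proof
  fix p
  have add: "r (p + q) = r p + r q" "r' (p + q) = r' p + r' q" for p q
    using assms by (simp_all add: is_rho_def)
  have smult: "r (smult a p) = smult a (r p)" "r' (smult a p) = smult a (r' p)" for a p
    using assms by (simp_all add: is_rho_def)
  have "r (fps_nth exp_Tu m) = r' (fps_nth exp_Tu m)" for m
    using assms unfolding is_rho_def by (metis fps_nth_Abs_fps)
  moreover have "monom a m = smult (fact m *\<^sub>Q a) (fps_nth exp_Tu m)" for a :: 'b and m
    by (simp add: exp_Tu_def smult_monom scaleQ_mult_left scaleQ_mult_right)
  ultimately have monom: "r (monom a m) = r' (monom a m)" for a m
    by (simp add: smult)
  have zero: "r 0 = 0" "r' 0 = 0" using smult(1)[of 0 0] smult(2)[of 0 0] by simp_all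
  have "r (\<Sum>i\<in>A. monom (coeff p i) i) = r' (\<Sum>i\<in>A. monom (coeff p i) i)" if "finite A" for A
    using that by (induction A) (simp_all add: zero add monom)
  from this[of "{..degree p}"] show "r p = r' p"
    by (simp add: poly_as_sum_of_monoms)
qed

lemma rho_eq: "rho Z = shift_op (fps_nth (rho_series Z))"
  unfolding rho_def by (rule the_equality, rule is_rho_shift_op, erule is_rho_unique[OF _ is_rho_shift_op])

text \<open>Since \<open>rho\<close> is a power series in \<open>d/dT\<close>, its inverse is given by the inverse series.\<close>

lemma inv_rho:
  fixes s :: "'a :: comm_rat_algebra fps"
  assumes "rho_series Z = fps_expQ s" and s: "fps_nth s 0 = 0"
  shows "inv (rho Z) = shift_op (fps_nth (fps_expQ (- s)))"
proof -
  let ?b = "fps_nth (fps_expQ (- s))" and ?c = "fps_nth (fps_expQ s)"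
  have cb: "(\<Sum>k\<le>n. ?c k * ?b (n - k)) = (if n = 0 then 1 else 0)" for n
    using arg_cong[OF fps_expQ_uminus[OF s], of "\<lambda>f. fps_nth f n"]
    by (simp add: fps_mult_nth atLeast0AtMost)
  have bc: "(\<Sum>k\<le>n. ?b k * ?c (n - k)) = (if n = 0 then 1 else 0)" for n
    using arg_cong[OF fps_expQ_uminus[OF s], of "\<lambda>f. fps_nth f n"]
    unfolding mult.commute[of "fps_expQ s"] by (simp add: fps_mult_nth atLeast0AtMost)
  show ?thesis
    unfolding rho_eq assms(1)
    by (rule inv_unique_comp) (auto simp: fun_eq_iff shift_op_inverse[OF cb] shift_op_inverse[OF bc])
qed

section \<open>The series \<open>Phi_star\<close>\<close>

text \<open>
  The exponent of \<open>Phi_corr F\<close> as a power series in the letter \<open>Y 0 0\<close>. For \<open>F = Phi_reg Z\<close>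
  the exponent of \<open>rho_series Z\<close> is its negative.
\<close>

definition corr_exponent :: "('g :: {finite, ab_group_add} xletter, 'a :: comm_rat_algebra) series \<Rightarrow> 'a fps" where
  "corr_exponent F = Abs_fps (\<lambda>n. if n \<ge> 2
     then ((-1) ^ (n - 1) / of_nat n) *\<^sub>Q F (replicate (n - 1) X0 @ [X 0]) else 0)"

lemma corr_exponent_0: "fps_nth (corr_exponent F) 0 = 0"
  by (simp add: corr_exponent_def)

lemma Phi_corr_eq:
  fixes F :: "('g :: {finite, ab_group_add} xletter, 'a :: comm_rat_algebra) series"
  shows "Phi_corr F w = (if w = replicate (length w) (Y 0 0)
     then fps_nth (fps_expQ (corr_exponent F)) (length w) else 0)"
proof -
  have "(\<lambda>w :: 'g yletter list. let n = length w in if n \<ge> 2 \<and> w = replicate n (Y 0 0)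
      then ((-1) ^ (n - 1) / of_nat n) *\<^sub>Q F (replicate (n - 1) X0 @ [X 0]) else 0) =
    (\<lambda>w. if w = replicate (length w) (Y 0 0) then fps_nth (corr_exponent F) (length w) else 0)"
    by (auto simp: fun_eq_iff corr_exponent_def Let_def)
  then show ?thesis
    unfolding Phi_corr_def by (simp only: ser_exp_powers_of_letter)
qed

lemma ldel_pow_word:
  assumes "n \<le> length w"
  shows "(ldel x ^^ n) (word w) = (if take n w = replicate n x then word (drop n w) else 0)"
  using assms
proof (induction n arbitrary: w)
  case (Suc n)
  then obtain y v where "w = y # v" "n \<le> length v" by (cases w) auto
  then show ?case
    using Suc.IH[of v] by (cases "x = y") (simp_all add: funpow_Suc_right linQ_0[OF linQ_funpow[OF linQ_ldel]] del: funpow.simps)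
qed simp

text \<open>
  Left multiplication by a series in the single letter \<open>Y 0 0\<close> is dual to applying the same series
  in the derivation \<open>ldel (Y 0 0)\<close>.
\<close>

lemma lin_ext_Phi_star:
  obtains N where "\<And>M. M \<ge> N \<Longrightarrow> lin_ext (Phi_star F) a =
    (\<Sum>k\<le>M. fps_nth (fps_expQ (corr_exponent F)) k * lin_ext (pi_Y (q_ser F)) ((ldel (Y 0 0) ^^ k) a))"
proof -
  let ?b = "fps_nth (fps_expQ (corr_exponent F))" and ?P = "pi_Y (q_ser F)" and ?d = "ldel (Y 0 0)"
  obtain N where N: "\<And>w. length w \<ge> N \<Longrightarrow> Poly_Mapping.lookup a w = 0"
    using lookup_long_word[of a] by blast
  have word: "Phi_star F w = (\<Sum>k\<le>M. ?b k * lin_ext ?P ((?d ^^ k) (word w)))" if "length w \<le> M" for w M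
  proof -
    have "Phi_star F w = (\<Sum>k\<le>length w. ?b k * lin_ext ?P ((?d ^^ k) (word w)))"
      unfolding Phi_star_def ser_mult_def
      by (intro sum.cong refl) (simp add: Phi_corr_eq ldel_pow_word linQ_0[OF linQ_lin_ext] min_def)
    also have "\<dots> = (\<Sum>k\<le>M. ?b k * lin_ext ?P ((?d ^^ k) (word w)))"
    proof (rule sum.mono_neutral_left)
      show "\<forall>k\<in>{..M} - {..length w}. ?b k * lin_ext ?P ((?d ^^ k) (word w)) = 0"
      proof
        fix k assume "k \<in> {..M} - {..length w}"
        then have "(?d ^^ k) (word w) = 0"
          by (intro poly_mapping_eqI) (auto simp: lookup_ldel_pow lookup_word)
        then show "?b k * lin_ext ?P ((?d ^^ k) (word w)) = 0"
          by (simp add: linQ_0[OF linQ_lin_ext])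
      qed
    qed (use that in auto)
    finally show ?thesis .
  qed
  have "lin_ext (Phi_star F) a = (\<Sum>k\<le>M. ?b k * lin_ext ?P ((?d ^^ k) a))" if "M \<ge> N" for M
  proof -
    have lin: "linQ (\<lambda>a. \<Sum>k\<le>M. ?b k * lin_ext ?P ((?d ^^ k) a))"
      unfolding mult.commute[of "?b _"]
      by (intro linQ_summed linQ_times linQ_compose[OF linQ_lin_ext linQ_funpow[OF linQ_ldel]])
    have "lin_ext (Phi_star F) a =
        lin_ext (\<lambda>w. \<Sum>k\<le>M. ?b k * lin_ext ?P ((?d ^^ k) (word w))) a"
      unfolding lin_ext_def[of _ a]
    proof (intro sum.cong refl)
      fix w assume "w \<in> Poly_Mapping.keys a"
      then have "length w \<le> M" using N[of w] that by (force simp: in_keys_iff)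
      then show "Poly_Mapping.lookup a w *\<^sub>Q Phi_star F w = Poly_Mapping.lookup a w *\<^sub>Q
          (\<Sum>k\<le>M. ?b k * lin_ext ?P ((?d ^^ k) (word w)))"
        by (simp only: word)
    qed
    then show ?thesis by (simp only: linQ_eq_lin_ext[OF lin, of a])
  qed
  then show ?thesis by (rule that)
qed

lemma Phi_star_Nil: "Phi_star F [] = F []"
  by (simp add: Phi_star_def ser_mult_def Phi_corr_eq fps_expQ_nth[OF corr_exponent_0 order_refl] fps_pow_0
      pi_Y_def q_ser_eq y_word_def)

section \<open>The bijection between the two sets of solutions\<close>

lemma linear_H0_zero:
  fixes Z :: "'g :: {finite, ab_group_add} H \<Rightarrow> 'a :: comm_rat_algebra"
  assumes Z: "linearQ_on H0 Z"
  shows "Z 0 = 0"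
proof -
  have "(0 :: 'g H) \<in> H0" by (simp add: H0_eq linQ_0[OF linQ_ldel] linQ_0[OF linQ_rdel])
  then show ?thesis using Z scaleQ_zero_left[of "Z 0"] unfolding linearQ_on_def
    by (metis scaleQ_zero_right)
qed

text \<open>The linear extension of \<open>Phi_reg Z\<close> is the composition of \<open>Z\<close> with the regularization.\<close>

lemma lin_ext_Phi_reg:
  fixes Z :: "'g :: {finite, ab_group_add} H \<Rightarrow> 'a :: comm_rat_algebra"
  assumes Z: "linearQ_on H0 Z"
  shows "lin_ext (Phi_reg Z) p = Z (reg_dix p)"
proof -
  have "linQ (\<lambda>p. Z (reg_dix p))"
    using Z by (intro linQI) (simp_all add: linearQ_on_def reg_dix_H0 linQ_add[OF linQ_reg_dix] linQ_scale[OF linQ_reg_dix])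
  then show ?thesis by (simp add: linQ_eq_lin_ext[of "\<lambda>p. Z (reg_dix p)" p] Phi_reg_def reg_eq)
qed

lemma coeff_Z_sh:
  assumes "linearQ_on H0 Z"
  shows "coeff (Z_sh Z p) n = lin_ext (Phi_reg Z) (dpow (ldel (X 0)) n p)"
  by (simp add: Z_sh_def coeff_map_poly linear_H0_zero[OF assms] coeff_regT lin_ext_Phi_reg[OF assms])

lemma zeta_word_H0:
  assumes "n \<ge> 2"
  shows "word (replicate (n - 1) X0 @ [X 0]) \<in> H0"
proof -
  obtain k where "n - 1 = Suc k" using assms by (cases "n - 1") auto
  then show ?thesis
    using rdel_word(2)[of X0 "replicate (n - 1) X0" "X 0"] by (simp add: H0_eq)
qed

lemma rho_series_eq:
  fixes Z :: "'g :: {finite, ab_group_add} H \<Rightarrow> 'a :: comm_rat_algebra"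
  assumes "linearQ_on H0 Z"
  shows "rho_series Z = fps_expQ (- corr_exponent (Phi_reg Z))"
proof -
  have "Z (word (replicate (n - 1) X0 @ [X 0])) = Phi_reg Z (replicate (n - 1) X0 @ [X 0])"
    if "n \<ge> 2" for n
    by (simp only: Phi_reg_def reg_eq reg_dix_ident[OF zeta_word_H0[OF that]])
  moreover have "(- 1 :: rat) ^ n = - ((- 1) ^ (n - 1))" if "n \<ge> 2" for n
    using that by (cases n) simp_all
  ultimately have "Abs_fps (\<lambda>n. if n \<ge> 2 then ((-1) ^ n / of_nat n) *\<^sub>Q Z (word (replicate (n - 1) X0 @ [X 0])) else 0)
      = - corr_exponent (Phi_reg Z)"
    by (intro fps_ext) (simp add: corr_exponent_def scaleQ_minus_left)
  then show ?thesis unfolding rho_series_def by (rule arg_cong)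
qed

lemma lin_ext_pi_q: "lin_ext (pi_Y (q_ser F)) a = lin_ext F (y_to_H a)"
  by (rule linQ_eqI[OF linQ_lin_ext linQ_compose[OF linQ_lin_ext linQ_y_to_H]])
    (simp add: y_to_H_word pi_Y_def q_ser_eq)

text \<open>The map that has to be multiplicative for the harmonic product.\<close>

abbreviation harm_map where
  "harm_map Z \<equiv> inv (rho Z) \<circ> Z_sh Z \<circ> inv qG \<circ> y_embed"

text \<open>
  Both \<open>inv (rho Z)\<close> and the passage from \<open>pi_Y (q_ser F)\<close> to \<open>Phi_star F\<close> apply the same series, the
  former in \<open>d/dT\<close> and the latter in \<open>d = ldel (Y 0 0)\<close>. Hence \<open>harm_map Z\<close> is \<open>exp (T d)\<close> followed
  by the linear extension of \<open>Phi_star (Phi_reg Z)\<close>.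
\<close>

lemma coeff_harm_map:
  assumes Z: "linearQ_on H0 Z"
  shows "coeff (harm_map Z a) n = lin_ext (Phi_star (Phi_reg Z)) (dpow (ldel (Y 0 0)) n a)"
proof -
  let ?F = "Phi_reg Z" and ?d = "ldel (Y 0 0)"
  let ?b = "fps_nth (fps_expQ (corr_exponent ?F))" and ?P = "pi_Y (q_ser ?F)"
  let ?G = "Z_sh Z (y_to_H a)"
  have G: "fact m *\<^sub>Q coeff ?G m = lin_ext ?P ((?d ^^ m) a)" for m
    by (simp add: coeff_Z_sh[OF Z] dpow_y_to_H lin_ext_pi_q[symmetric] funpow_eq_dpow
        linQ_scale[OF linQ_lin_ext])
  have inv: "inv (rho Z) = shift_op ?b"
    using inv_rho[OF rho_series_eq[OF Z]] by (simp add: corr_exponent_0)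
  obtain N where N: "\<And>M. M \<ge> N \<Longrightarrow> lin_ext (Phi_star ?F) ((?d ^^ n) a) =
      (\<Sum>k\<le>M. ?b k * lin_ext ?P ((?d ^^ k) ((?d ^^ n) a)))"
    using lin_ext_Phi_star[of ?F "(?d ^^ n) a"] by blast
  define M where "M = max N (degree ?G)"
  have "coeff (harm_map Z a) n = coeff (shift_op ?b ?G) n"
    by (simp add: inv y_to_H_def)
  also have "\<dots> = (1 / fact n) *\<^sub>Q (\<Sum>k\<le>M. ?b k * (fact (n + k) *\<^sub>Q coeff ?G (n + k)))"
    by (rule coeff_shift_op) (simp add: M_def)
  also have "\<dots> = (1 / fact n) *\<^sub>Q (\<Sum>k\<le>M. ?b k * lin_ext ?P ((?d ^^ k) ((?d ^^ n) a)))"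
    by (simp only: G add.commute[of n] funpow_add comp_apply)
  also have "\<dots> = (1 / fact n) *\<^sub>Q lin_ext (Phi_star ?F) ((?d ^^ n) a)"
    by (subst N[of M]) (simp_all add: M_def)
  finally show ?thesis by (simp add: dpow_def linQ_scale[OF linQ_lin_ext])
qed

text \<open>
  A map of the form \<open>a \<mapsto> \<Sum>\<^sub>n \<psi> (d\<^sup>n a) T\<^sup>n / n!\<close>, for the derivation \<open>d\<close> removing a leading \<open>Y 0 0\<close>,
  is determined by its constant term, and the Leibniz rule passes multiplicativity from the constant
  term to the whole polynomial.
\<close>

lemma alg_hom_harm_iff:
  fixes f :: "'g :: {finite, ab_group_add} yletter falg \<Rightarrow> 'a :: comm_rat_algebra poly"
  assumes f: "\<And>a n. coeff (f a) n = lin_ext \<psi> (dpow (ldel (Y 0 0)) n a)" and one: "\<psi> [] = 1"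
  shows "alg_hom_on UNIV harm (word []) (*) [:1:] f \<longleftrightarrow>
    (\<forall>p q. lin_ext \<psi> (harm p q) = lin_ext \<psi> p * lin_ext \<psi> q)"
proof
  assume "alg_hom_on UNIV harm (word []) (*) [:1:] f"
  then have "coeff (f (harm p q)) 0 = coeff (f p) 0 * coeff (f q) 0" for p q
    by (simp add: alg_hom_on_def coeff_mult)
  then show "\<forall>p q. lin_ext \<psi> (harm p q) = lin_ext \<psi> p * lin_ext \<psi> q"
    by (simp add: f)
next
  assume mult: "\<forall>p q. lin_ext \<psi> (harm p q) = lin_ext \<psi> p * lin_ext \<psi> q"
  note lin = linQ_dpow[OF linQ_ldel]
  have "linQ f"
    by (rule linQI; rule poly_eqI)
      (simp_all add: f coeff_scaleQ linQ_add[OF lin] linQ_scale[OF lin] linQ_add[OF linQ_lin_ext]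
        linQ_scale[OF linQ_lin_ext])
  moreover have "f (word []) = [:1:]"
  proof (rule poly_eqI)
    fix n
    have "dpow (ldel (Y 0 (0 :: 'g))) n (word []) = 0" if "n \<ge> 1"
      using that by (intro dpow_eventually_0[OF linQ_ldel, of 1]) simp_all
    then show "coeff (f (word [])) n = coeff [:1:] n"
      by (cases n) (simp_all add: f one linQ_0[OF linQ_lin_ext])
  qed
  moreover have "f (harm p q) = f p * f q" for p q
    by (rule poly_eqI)
      (simp add: f coeff_mult mult linQ_sum[OF linQ_lin_ext]
        dpow_leibniz[where m = harm, OF linQ_ldel linQ_harm_left linQ_harm_right ldel_harm])
  ultimately show "alg_hom_on UNIV harm (word []) (*) [:1:] f"
    by (simp add: alg_hom_on_def)
qed

lemma harm_condition_iff:
  fixes Z :: "'g :: {finite, ab_group_add} H \<Rightarrow> 'a :: comm_rat_algebra"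
  assumes "linearQ_on H0 Z" and "Phi_reg Z [] = 1"
  shows "alg_hom_on UNIV harm (word []) (*) [:1:] (harm_map Z) \<longleftrightarrow>
    delta_harm (Phi_star (Phi_reg Z)) = tens (Phi_star (Phi_reg Z)) (Phi_star (Phi_reg Z))"
  unfolding delta_harm_grouplike_iff
  by (rule alg_hom_harm_iff) (simp_all only: coeff_harm_map[OF assms(1)] Phi_star_Nil assms(2))

lemma Phi_reg_in_DMR:
  assumes "Z \<in> EDS"
  shows "Phi_reg Z \<in> DMR"
proof -
  have lin: "linearQ_on H0 Z" and hom: "alg_hom_on H0 sh (word []) (*) 1 Z"
    and harm: "alg_hom_on UNIV harm (word []) (*) [:1:] (harm_map Z)"
    using assms by (auto simp: EDS_def)
  have one: "Phi_reg Z [] = 1"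
    using hom by (simp add: Phi_reg_def reg_eq reg_dix_ident one_H0 alg_hom_on_def)
  have "delta_sh (Phi_reg Z) = tens (Phi_reg Z) (Phi_reg Z)"
    unfolding delta_sh_grouplike_iff using hom
    by (simp add: lin_ext_Phi_reg[OF lin] reg_dix_sh reg_dix_H0 alg_hom_on_def)
  moreover have "Phi_reg Z [X0] = 0" "Phi_reg Z [X 0] = 0"
    by (simp_all add: Phi_reg_def reg_eq reg_dix_X0 reg_dix_X linear_H0_zero[OF lin])
  ultimately show ?thesis
    using harm harm_condition_iff[OF lin one] one by (simp add: DMR_def)
qed

text \<open>The inverse of \<open>Phi_reg\<close>, taking the value \<open>undefined\<close> outside \<open>H0\<close>.\<close>

definition series_to_map ::
  "('g :: {finite, ab_group_add} xletter, 'a :: comm_rat_algebra) series \<Rightarrow> 'g H \<Rightarrow> 'a" where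
  "series_to_map F = restrict (lin_ext F) H0"

lemma series_to_map_Phi_reg:
  assumes "Z \<in> EDS"
  shows "series_to_map (Phi_reg Z) = Z"
proof (rule extensionalityI[of _ H0])
  have lin: "linearQ_on H0 Z" and ext: "Z \<in> extensional H0"
    using assms by (auto simp: EDS_def)
  show "series_to_map (Phi_reg Z) \<in> extensional H0" by (simp add: series_to_map_def)
  show "Z \<in> extensional H0" by (rule ext)
  show "series_to_map (Phi_reg Z) p = Z p" if "p \<in> H0" for p
    using that by (simp add: series_to_map_def lin_ext_Phi_reg[OF lin] reg_dix_ident)
qed

lemma Phi_reg_series_to_map:
  assumes "F \<in> DMR"
  shows "Phi_reg (series_to_map F) = F"
proof
  fix w
  have mult: "lin_ext F (sh p q) = lin_ext F p * lin_ext F q" for p q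
    using assms by (simp add: DMR_def delta_sh_grouplike_iff)
  have "lin_ext F (reg_dix p) = lin_ext F p" for p
  proof -
    have "lin_ext F (leading.dix (trailing.dix p)) = lin_ext F (trailing.dix p)"
      by (rule leading.hom_dix) (use assms in \<open>simp_all add: linQ_lin_ext mult DMR_def\<close>)
    also have "\<dots> = lin_ext F p"
      by (rule trailing.hom_dix) (use assms in \<open>simp_all add: linQ_lin_ext mult DMR_def\<close>)
    finally show ?thesis by (simp add: reg_dix_def)
  qed
  then show "Phi_reg (series_to_map F) w = F w"
    by (simp add: Phi_reg_def reg_eq series_to_map_def reg_dix_H0)
qed

lemma series_to_map_in_EDS:
  fixes F :: "('g :: {finite, ab_group_add} xletter, 'a :: comm_rat_algebra) series"
  assumes F: "F \<in> DMR"
  shows "series_to_map F \<in> EDS"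
proof -
  let ?Z = "series_to_map F"
  have closed: "p + q \<in> H0" "r *\<^sub>Q p \<in> H0" "sh p q \<in> H0" if "p \<in> H0" "q \<in> H0"
    for p q :: "'g H" and r
    using that by (simp_all add: H0_eq linQ_add[OF linQ_ldel] linQ_scale[OF linQ_ldel]
        linQ_add[OF linQ_rdel] linQ_scale[OF linQ_rdel] ldel_sh rdel_sh)
  have lin: "linearQ_on H0 ?Z"
    by (simp add: linearQ_on_def series_to_map_def closed linQ_add[OF linQ_lin_ext]
        linQ_scale[OF linQ_lin_ext])
  have "alg_hom_on H0 sh (word []) (*) 1 ?Z"
    using F lin by (simp add: alg_hom_on_def series_to_map_def closed one_H0 DMR_def
        delta_sh_grouplike_iff)
  moreover have "alg_hom_on UNIV harm (word []) (*) [:1:] (harm_map ?Z)"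
    using F harm_condition_iff[OF lin] by (simp add: Phi_reg_series_to_map[OF F] DMR_def)
  ultimately show ?thesis
    using lin by (simp add: EDS_def series_to_map_def)
qed

theorem theorem2:
  shows "bij_betw Phi_reg
    (EDS :: ('g :: {finite, ab_group_add} H \<Rightarrow> 'a :: comm_rat_algebra) set)
    (DMR :: ('g xletter, 'a) series set)"
  by (rule bij_betwI[where g = series_to_map])
    (simp_all add: Phi_reg_in_DMR series_to_map_in_EDS series_to_map_Phi_reg Phi_reg_series_to_map)

end
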